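(* Let $A,T\in\mathbb{B}(\mathcal{H})$ and suppose that $W(A)$ and $W(T)$ are contained in the closed disks $D(\lambda_0,R_A)$ and $D(\mu_0,R_T)$ respectively. Then for any $P\in\mathcal{S}(\mathcal{H})$, $$|tr(PAT)-tr(PA)tr(PT)|\le \sup_{\widetilde P\in\mathcal{S}(\mathcal{H})}|tr(\widetilde PAT)-tr(\widetilde PA)tr(\widetilde PT)|\le dist(A,\mathbb{C}Id)\,dist(T,\mathbb{C}Id)$$ $$\le \|A-\lambda_0Id\|\,\|T-\mu_0Id\|\le 4\,w(A-\lambda_0Id)\,w(T-\mu_0Id)\le 4R_AR_T.$$ In particular, if $A$ and $T$ are normal operators, then $$|tr(PAT)-tr(PA)tr(PT)|\le \sup_{\widetilde P\in\mathcal{S}(\mathcal{H})}|tr(\widetilde PAT)-tr(\widetilde PA)tr(\widetilde PT)|\le dist(A,\mathbb{C}Id)\,dist(T,\mathbb{C}Id)=r_Ar_T,$$ where $r_S$ denotes the radius of the unique smallest disc containing the spectrum $\sigma(S)$, for $S\in\mathbb{B}(\mathcal{H})$.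
   Context: $\mathcal{H}$ is a complex separable Hilbert space with inner product $\langle\cdot,\cdot\rangle$, $\mathbb{B}(\mathcal{H})$ is the algebra of bounded linear operators on $\mathcal{H}$ with operator norm $\|\cdot\|$, and $Id$ is the identity operator. $\mathcal{S}(\mathcal{H})$ denotes the set of density operators (states): positive trace class operators $P$ with $tr(P)=1$. For $S\in\mathbb{B}(\mathcal{H})$, $W(S)=\{\langle Sh,h\rangle:\|h\|=1\}$ is the numerical range, $w(S)=\sup\{|z|:z\in W(S)\}$ the numerical radius, and $dist(S,\mathbb{C}Id)=\inf_{z\in\mathbb{C}}\|S-zId\|$. $D(z_0,R)$ is the closed disk in $\mathbb{C}$ with center $z_0$ and radius $R$. *)

theory Defs
  imports "HOL-Analysis.Analysis"
begin

section \<open>Complex Hilbert spaces\<close>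

text \<open>The inner product is linear in the \<^emph>\<open>first\<close> argument, so that the numerical range of
  \<open>z Id\<close> is \<open>{z}\<close>.  Norm and topology are those induced by the inner product, and the real
  vector space structure is the restriction of the complex one.\<close>

class chilbert_space = banach +
  fixes scaleC :: "complex \<Rightarrow> 'a \<Rightarrow> 'a"  (infixr \<open>*\<^sub>C\<close> 75)
    and cinner :: "'a \<Rightarrow> 'a \<Rightarrow> complex"
  assumes scaleC_add_right: "z *\<^sub>C (x + y) = z *\<^sub>C x + z *\<^sub>C y"
    and scaleC_add_left: "(z + w) *\<^sub>C x = z *\<^sub>C x + w *\<^sub>C x"
    and scaleC_scaleC: "z *\<^sub>C w *\<^sub>C x = (z * w) *\<^sub>C x"
    and scaleR_eq_scaleC: "r *\<^sub>R x = complex_of_real r *\<^sub>C x"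
    and cinner_add_left: "cinner (x + y) v = cinner x v + cinner y v"
    and cinner_scaleC_left: "cinner (z *\<^sub>C x) v = z * cinner x v"
    and cinner_commute: "cinner x y = cnj (cinner y x)"
    and cinner_self: "cinner x x = complex_of_real ((norm x)\<^sup>2)"

lemma scaleC_one: "1 *\<^sub>C x = (x :: 'a::chilbert_space)"
  by (metis of_real_1 scaleR_eq_scaleC scaleR_one)

global_interpretation complex_vector: vector_space "scaleC :: complex \<Rightarrow> 'a \<Rightarrow> 'a::chilbert_space"
  by unfold_locales (simp_all add: scaleC_add_right scaleC_add_left scaleC_scaleC scaleC_one)

definition orthonormal_basis :: "'a::chilbert_space set \<Rightarrow> bool" where
  "orthonormal_basis B \<longleftrightarrow>
     (\<forall>e\<in>B. \<forall>f\<in>B. cinner e f = (if e = f then 1 else 0)) \<and> closure (complex_vector.span B) = UNIV"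

section \<open>Bounded operators\<close>

text \<open>Elements of the algebra of bounded operators are functions satisfying the predicate below;
  the operator norm is \<^const>\<open>onorm\<close>, the product is composition.\<close>

definition bounded_clinear :: "('a::chilbert_space \<Rightarrow> 'a) \<Rightarrow> bool" where
  "bounded_clinear S \<longleftrightarrow> bounded_linear S \<and> (\<forall>z x. S (z *\<^sub>C x) = z *\<^sub>C S x)"

definition shift_op :: "('a::chilbert_space \<Rightarrow> 'a) \<Rightarrow> complex \<Rightarrow> 'a \<Rightarrow> 'a" where
  "shift_op S z = (\<lambda>x. S x - z *\<^sub>C x)"

definition op_adj :: "('a::chilbert_space \<Rightarrow> 'a) \<Rightarrow> 'a \<Rightarrow> 'a" where
  "op_adj S = (THE S'. \<forall>x y. cinner (S x) y = cinner x (S' y))"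

definition normal_op :: "('a::chilbert_space \<Rightarrow> 'a) \<Rightarrow> bool" where
  "normal_op S \<longleftrightarrow> bounded_clinear S \<and> S \<circ> op_adj S = op_adj S \<circ> S"

definition positive_op :: "('a::chilbert_space \<Rightarrow> 'a) \<Rightarrow> bool" where
  "positive_op S \<longleftrightarrow> bounded_clinear S \<and> (\<forall>x. cinner (S x) x \<in> \<real>\<^sub>\<ge>\<^sub>0)"

definition op_abs :: "('a::chilbert_space \<Rightarrow> 'a) \<Rightarrow> 'a \<Rightarrow> 'a" where
  "op_abs S = (THE Q. positive_op Q \<and> Q \<circ> Q = op_adj S \<circ> S)"

definition trace_class :: "('a::chilbert_space \<Rightarrow> 'a) \<Rightarrow> bool" where
  "trace_class S \<longleftrightarrow> bounded_clinear S \<and>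
     (\<exists>B. orthonormal_basis B \<and> (\<lambda>e. cinner (op_abs S e) e) summable_on B)"

text \<open>Only meaningful for trace class operators, where the sum does not depend on the basis.\<close>

definition op_trace :: "('a::chilbert_space \<Rightarrow> 'a) \<Rightarrow> complex" where
  "op_trace S = (\<Sum>\<^sub>\<infinity>e\<in>(SOME B. orthonormal_basis B). cinner (S e) e)"

definition density_operators :: "('a::chilbert_space \<Rightarrow> 'a) set" where
  "density_operators = {P. positive_op P \<and> trace_class P \<and> op_trace P = 1}"

section \<open>Numerical range, distance to the scalars, spectrum\<close>

definition numerical_range :: "('a::chilbert_space \<Rightarrow> 'a) \<Rightarrow> complex set" where
  "numerical_range S = {cinner (S h) h | h. norm h = 1}"

definition numerical_radius :: "('a::chilbert_space \<Rightarrow> 'a) \<Rightarrow> real" where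
  "numerical_radius S = (SUP z\<in>numerical_range S. cmod z)"

definition dist_scalars :: "('a::chilbert_space \<Rightarrow> 'a) \<Rightarrow> real" where
  "dist_scalars S = (INF z. onorm (shift_op S z))"

definition op_invertible :: "('a::chilbert_space \<Rightarrow> 'a) \<Rightarrow> bool" where
  "op_invertible S \<longleftrightarrow> (\<exists>R. bounded_clinear R \<and> R \<circ> S = id \<and> S \<circ> R = id)"

definition op_spectrum :: "('a::chilbert_space \<Rightarrow> 'a) \<Rightarrow> complex set" where
  "op_spectrum S = {z. \<not> op_invertible (shift_op S z)}"

definition smallest_disc :: "complex set \<Rightarrow> complex \<times> real \<Rightarrow> bool" where
  "smallest_disc K D \<longleftrightarrow> K \<subseteq> cball (fst D) (snd D) \<and>
     (\<forall>c r. K \<subseteq> cball c r \<longrightarrow> snd D \<le> r)"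

text \<open>The description operator picks the disc, i.e. both centre and radius: the definition relies
  on the smallest disc being unique, not merely on the uniqueness of its radius.\<close>

definition spectral_disc_radius :: "('a::chilbert_space \<Rightarrow> 'a) \<Rightarrow> real" where
  "spectral_disc_radius S = snd (THE D. smallest_disc (op_spectrum S) D)"

end

theory Submission
  imports Defs
begin

text \<open>A state \<open>P\<close> is a sum \<open>\<Sum>n. |v n\<rangle>\<langle>v n|\<close> with \<open>\<Sum>n. \<parallel>v n\<parallel>\<^sup>2 = 1\<close>, so that
  \<open>tr (P S) = \<Sum>n. \<langle>S v n, v n\<rangle>\<close> for bounded \<open>S\<close> (\<open>trace_as_vector_states\<close>).  The vectors come from a
  Cholesky elimination of \<open>P\<close> along an orthonormal basis.  The covariance
  \<open>tr (P A T) - tr (P A) tr (P T)\<close> then is an inner product of square summable sequences of vectors,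
  and Cauchy-Schwarz bounds it by \<open>\<parallel>A\<parallel> \<parallel>T\<parallel>\<close> (\<open>covariance_bound\<close>).  As it does not change when scalars
  are subtracted from \<open>A\<close> and \<open>T\<close>, it is bounded by \<open>\<parallel>A - z\<parallel> \<parallel>T - w\<parallel>\<close> for all \<open>z\<close> and \<open>w\<close>, hence by the
  product of the distances to the scalars.  The passage to numerical radii is the
  inequality \<open>\<parallel>S\<parallel> \<le> 2 w(S)\<close>, which follows by polarisation.

  For normal \<open>S\<close> the point is that the norm of \<open>S - z\<close> is attained as the modulus of a spectral value
  (\<open>normal_onorm_in_spectrum\<close>).  This makes \<open>\<parallel>S - z\<parallel>\<close> the least radius of a disc around \<open>z\<close> that
  contains the spectrum, and minimising over \<open>z\<close> identifies the distance to the scalars with the radius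
  of the smallest disc.  The spectral value is found without complex function theory: if
  \<open>N - \<mu>\<close> were invertible on the whole circle \<open>|\<mu>| = \<parallel>N\<parallel>\<close>, its lower bounds there would control the
  partial sums of \<open>\<Sum>k. \<mu>\<^sup>-\<^sup>k N\<^sup>k x\<close> uniformly, but their mean square over the circle grows linearly in the
  number of terms when \<open>N\<close> is normal and \<open>x\<close> nearly attains the norm.\<close>

section \<open>Inner product algebra\<close>

lemma cinner_add_right: "cinner x (y + z) = cinner x y + cinner x (z :: 'a::chilbert_space)"
  by (metis cinner_add_left cinner_commute complex_cnj_add)

lemma cinner_scaleC_right: "cinner x (z *\<^sub>C y) = cnj z * cinner x (y :: 'a::chilbert_space)"
  by (metis cinner_scaleC_left cinner_commute complex_cnj_mult)

lemma cinner_zero_left [simp]: "cinner 0 (y :: 'a::chilbert_space) = 0"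
  using cinner_add_left[of 0 0 y] by simp

lemma cinner_zero_right [simp]: "cinner (y :: 'a::chilbert_space) 0 = 0"
  using cinner_add_right[of y 0 0] by simp

lemma cinner_minus_left: "cinner (- x) y = - cinner x (y :: 'a::chilbert_space)"
  using cinner_add_left[of x "- x" y] by (simp add: add_eq_0_iff)

lemma cinner_minus_right: "cinner y (- x) = - cinner (y :: 'a::chilbert_space) x"
  using cinner_add_right[of y x "- x"] by (simp add: add_eq_0_iff)

lemma cinner_diff_left: "cinner (x - y) z = cinner x z - cinner y (z :: 'a::chilbert_space)"
  using cinner_add_left[of x "- y" z] by (simp add: cinner_minus_left)

lemma cinner_diff_right: "cinner z (x - y) = cinner (z :: 'a::chilbert_space) x - cinner z y"
  using cinner_add_right[of z x "- y"] by (simp add: cinner_minus_right)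

lemma cinner_sum_left: "cinner (sum f F) y = (\<Sum>i\<in>F. cinner (f i) (y :: 'a::chilbert_space))"
  by (induction F rule: infinite_finite_induct) (auto simp: cinner_add_left)

lemma cinner_sum_right: "cinner (y :: 'a::chilbert_space) (sum f F) = (\<Sum>i\<in>F. cinner y (f i))"
  by (induction F rule: infinite_finite_induct) (auto simp: cinner_add_right)

lemmas cinner_simps = cinner_add_left cinner_add_right cinner_diff_left cinner_diff_right
  cinner_scaleC_left cinner_scaleC_right cinner_minus_left cinner_minus_right

lemma Re_cinner_self: "Re (cinner x x) = (norm (x :: 'a::chilbert_space))\<^sup>2"
  by (simp add: cinner_self)

lemma cmod_cinner_commute: "cmod (cinner x y) = cmod (cinner y (x :: 'a::chilbert_space))"
  by (metis cinner_commute complex_mod_cnj)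

lemma cmod_power2_cinner: "complex_of_real ((cmod (cinner x y))\<^sup>2) = cinner x y * cinner y (x :: 'a::chilbert_space)"
  using complex_norm_square[of "cinner x y"] cinner_commute[of y x] by simp

lemma norm_scaleC: "norm (z *\<^sub>C x) = cmod z * norm (x :: 'a::chilbert_space)"
proof -
  have "complex_of_real ((norm (z *\<^sub>C x))\<^sup>2) = (z * cnj z) * cinner x x"
    by (simp only: cinner_self [symmetric] cinner_simps mult_ac)
  also have "\<dots> = complex_of_real ((cmod z * norm x)\<^sup>2)"
    using complex_norm_square[of z] by (simp add: cinner_self power_mult_distrib)
  finally have "complex_of_real ((norm (z *\<^sub>C x))\<^sup>2) = complex_of_real ((cmod z * norm x)\<^sup>2)" .
  then have "(norm (z *\<^sub>C x))\<^sup>2 = (cmod z * norm x)\<^sup>2"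
    using of_real_eq_iff by blast
  then show ?thesis
    by (simp add: power2_eq_iff_nonneg)
qed

lemma cinner_ext:
  assumes "\<And>z. cinner z x = cinner z (y :: 'a::chilbert_space)"
  shows "x = y"
  using assms[of "x - y"] cinner_self[of "x - y"] by (simp add: cinner_diff_right)

lemma norm_add_power2:
  "(norm (x + y :: 'a::chilbert_space))\<^sup>2 = (norm x)\<^sup>2 + 2 * Re (cinner x y) + (norm y)\<^sup>2"
  using cinner_commute[of y x]
  by (simp flip: Re_cinner_self add: cinner_simps)

lemma norm_diff_power2:
  "(norm (x - y :: 'a::chilbert_space))\<^sup>2 = (norm x)\<^sup>2 - 2 * Re (cinner x y) + (norm y)\<^sup>2"
  using cinner_commute[of y x]
  by (simp flip: Re_cinner_self add: cinner_simps)

lemma bounded_linear_scaleC: "bounded_linear (\<lambda>x :: 'a::chilbert_space. z *\<^sub>C x)"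
  by (rule bounded_linear_intro[where K = "cmod z"])
    (auto simp: scaleC_add_right scaleR_eq_scaleC scaleC_scaleC norm_scaleC mult_ac)

lemma bounded_clinear_bounded_linear: "bounded_clinear S \<Longrightarrow> bounded_linear S"
  by (simp add: bounded_clinear_def)

lemma bounded_clinear_scaleC: "bounded_clinear S \<Longrightarrow> S (z *\<^sub>C x) = z *\<^sub>C S x"
  by (simp add: bounded_clinear_def)

lemma bounded_clinear_add: "bounded_clinear S \<Longrightarrow> S (x + y) = S x + S y"
  by (simp add: bounded_clinear_def linear_simps)

lemma bounded_clinear_diff: "bounded_clinear S \<Longrightarrow> S (x - y) = S x - S y"
  by (simp add: bounded_clinear_def linear_simps)

lemma bounded_clinear_zero: "bounded_clinear S \<Longrightarrow> S 0 = 0"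
  by (simp add: bounded_clinear_def linear_simps)

lemma bounded_clinear_compose:
  "bounded_clinear S \<Longrightarrow> bounded_clinear R \<Longrightarrow> bounded_clinear (S \<circ> R)"
  by (auto simp: bounded_clinear_def o_def bounded_linear_compose)

lemma bounded_clinear_id: "bounded_clinear id"
  by (simp add: bounded_clinear_def id_def)

lemma bounded_clinear_shift: "bounded_clinear S \<Longrightarrow> bounded_clinear (shift_op S z)"
  by (auto simp: bounded_clinear_def shift_op_def bounded_linear_sub bounded_linear_scaleC
      scaleC_scaleC mult.commute complex_vector.scale_right_diff_distrib)

lemma norm_le_onorm: "bounded_clinear S \<Longrightarrow> norm (S x) \<le> onorm S * norm x"
  by (simp add: bounded_clinear_def onorm)

section \<open>Positive operators\<close>

text \<open>Over the complex numbers a real quadratic form is automatically Hermitian: test it on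
  \<open>x + y\<close> and on \<open>x + \<i> y\<close>.\<close>

lemma positive_op_selfadjoint:
  assumes "positive_op Q"
  shows "cinner (Q x) y = cinner x (Q y)"
proof -
  have lin: "bounded_clinear Q" and real: "Im (cinner (Q z) z) = 0" for z
    using assms by (auto simp: positive_op_def complex_nonneg_Reals_iff)
  have "Im (cinner (Q x) y + cinner (Q y) x) = 0"
    using real[of "x + y"] real[of x] real[of y]
    by (simp add: bounded_clinear_add[OF lin] cinner_simps)
  moreover have "Re (cinner (Q x) y) = Re (cinner (Q y) x)"
    using real[of "x + \<i> *\<^sub>C y"] real[of x] real[of y]
    by (simp add: bounded_clinear_add[OF lin] bounded_clinear_scaleC[OF lin] cinner_simps)
  ultimately have "cinner (Q x) y = cnj (cinner (Q y) x)"
    by (simp add: complex_eq_iff)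
  then show ?thesis
    by (simp flip: cinner_commute)
qed

text \<open>Minimise the nonnegative expression \<open>\<langle>Q (x + t y), x + t y\<rangle>\<close> over the line
  \<open>t \<in> \<real> \<cdot> \<langle>Q x, y\<rangle>\<close>.\<close>

lemma positive_op_Cauchy_Schwarz:
  assumes "positive_op Q"
  shows "(cmod (cinner (Q x) y))\<^sup>2 \<le> Re (cinner (Q x) x) * Re (cinner (Q y) y)"
proof -
  define a d c where "a = Re (cinner (Q x) x)" and "d = Re (cinner (Q y) y)" and "c = cinner (Q x) y"
  have lin: "bounded_clinear Q" and nn: "Re (cinner (Q z) z) \<ge> 0" for z
    using assms by (auto simp: positive_op_def complex_nonneg_Reals_iff)
  have yx: "cinner (Q y) x = cnj c"
    unfolding c_def by (metis assms cinner_commute positive_op_selfadjoint)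
  have quad: "0 \<le> a - 2 * s * (cmod c)\<^sup>2 + s\<^sup>2 * (cmod c)\<^sup>2 * d" for s :: real
  proof -
    have "0 \<le> Re (cinner (Q (x - (s * c) *\<^sub>C y)) (x - (s * c) *\<^sub>C y))"
      by (rule nn)
    also have "\<dots> = a - 2 * s * (cmod c)\<^sup>2 + s\<^sup>2 * (cmod c)\<^sup>2 * d"
    proof -
      have "Im (cinner (Q y) y) = 0"
        using assms by (auto simp: positive_op_def complex_nonneg_Reals_iff)
      then show ?thesis
        unfolding a_def d_def
        by (simp add: bounded_clinear_diff[OF lin] bounded_clinear_scaleC[OF lin] cinner_simps yx
            cmod_power2 flip: c_def) (simp add: algebra_simps power2_eq_square)
    qed
    finally show ?thesis .
  qed
  have "(cmod c)\<^sup>2 \<le> a * d"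
  proof (cases "d = 0")
    case True
    have "c = 0"
    proof (rule ccontr)
      assume "c \<noteq> 0"
      then have "a - 2 * ((a + 1) / (2 * (cmod c)\<^sup>2)) * (cmod c)\<^sup>2 = - 1"
        by (simp add: field_simps)
      then show False
        using quad[of "(a + 1) / (2 * (cmod c)\<^sup>2)"] True by simp
    qed
    then show ?thesis by (simp add: True)
  next
    case False
    then have "d > 0" using nn[of y] by (simp add: d_def)
    then show ?thesis
      using quad[of "1 / d"] by (simp add: field_simps power2_eq_square)
  qed
  then show ?thesis by (simp add: a_def d_def c_def)
qed

lemma positive_op_id: "positive_op id"
  by (simp add: positive_op_def bounded_clinear_id cinner_self complex_nonneg_Reals_iff)

lemma cinner_Cauchy_Schwarz: "cmod (cinner x y) \<le> norm x * norm (y :: 'a::chilbert_space)"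
proof -
  have "(cmod (cinner x y))\<^sup>2 \<le> (norm x * norm y)\<^sup>2"
    using positive_op_Cauchy_Schwarz[OF positive_op_id, of x y]
    by (simp add: Re_cinner_self power_mult_distrib)
  then show ?thesis
    by (rule power2_le_imp_le) simp
qed

lemma positive_op_eq_zero:
  assumes "positive_op Q" and "Re (cinner (Q x) x) = 0"
  shows "Q x = 0"
proof -
  have "cinner (Q x) (Q x) = 0"
    using positive_op_Cauchy_Schwarz[OF assms(1), of x "Q x"] assms(2) by simp
  then show ?thesis by (simp add: cinner_self)
qed

lemma bounded_clinear_rank_one: "bounded_clinear (\<lambda>x. cinner x v *\<^sub>C (w :: 'a::chilbert_space))"
proof -
  have "bounded_linear (\<lambda>x. cinner x v *\<^sub>C w)"
    by (rule bounded_linear_intro[where K = "norm v * norm w"])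
      (auto simp: cinner_add_left scaleR_eq_scaleC cinner_scaleC_left scaleC_scaleC scaleC_add_left
        norm_scaleC mult_right_mono cinner_Cauchy_Schwarz simp flip: mult.assoc)
  then show ?thesis
    by (simp add: bounded_clinear_def cinner_scaleC_left scaleC_scaleC)
qed

lemma bounded_clinear_minus:
  "bounded_clinear S \<Longrightarrow> bounded_clinear R \<Longrightarrow> bounded_clinear (\<lambda>x. S x - R x)"
  by (auto simp: bounded_clinear_def bounded_linear_sub complex_vector.scale_right_diff_distrib)

section \<open>Adjoints\<close>

text \<open>The representing vector minimises \<open>\<parallel>x\<parallel>\<^sup>2 - 2 Re (f x)\<close>: the parallelogram law makes every
  minimising sequence Cauchy, and the first variation at the minimiser is the claim.\<close>

lemma Riesz_representation:
  fixes f :: "'a::chilbert_space \<Rightarrow> complex"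
  assumes add: "\<And>x y. f (x + y) = f x + f y" and scale: "\<And>z x. f (z *\<^sub>C x) = z * f x"
    and bound: "\<And>x. cmod (f x) \<le> K * norm x"
  shows "\<exists>u. \<forall>x. f x = cinner x u"
proof -
  define J where "J x = (norm x)\<^sup>2 - 2 * Re (f x)" for x
  have bl: "bounded_linear f"
    by (rule bounded_linear_intro[where K = K])
      (auto simp: add scale scaleR_eq_scaleC scaleR_conv_of_real bound mult.commute)
  have "J x \<ge> - (K\<^sup>2)" for x
  proof -
    have "Re (f x) \<le> K * norm x"
      using bound[of x] complex_Re_le_cmod[of "f x"] by linarith
    then show ?thesis
      using zero_le_power2[of "norm x - K"] by (simp add: J_def power2_eq_square algebra_simps)
  qed
  then have bdd: "bdd_below (range J)"
    by (auto intro!: bdd_belowI)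
  define m where "m = (INF x. J x)"
  have m_le: "m \<le> J x" for x
    unfolding m_def by (rule cINF_lower[OF bdd]) simp
  have "\<exists>x. J x < m + 1 / Suc n" for n
    using cINF_less_iff[of UNIV J "m + 1 / Suc n"] bdd by (simp add: m_def)
  then obtain X where X: "J (X n) < m + 1 / Suc n" for n
    by metis
  have para: "(norm (x - y))\<^sup>2 = 2 * J x + 2 * J y - 4 * J ((1/2) *\<^sub>R (x + y))" for x y
    unfolding J_def linear_simps(5)[OF bl] linear_simps(1)[OF bl] norm_scaleR
    by (simp add: norm_diff_power2 norm_add_power2 power_divide) (simp add: field_simps)
  have close: "(norm (X i - X j))\<^sup>2 < 4 / Suc N" if "N \<le> i" "N \<le> j" for N i j
  proof -
    have "1 / real (Suc i) \<le> 1 / Suc N" "1 / real (Suc j) \<le> 1 / Suc N"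
      using that by (auto simp: field_simps)
    then show ?thesis
      using para[of "X i" "X j"] X[of i] X[of j] m_le[of "(1/2) *\<^sub>R (X i + X j)"] by simp
  qed
  have "Cauchy X"
  proof (rule CauchyI)
    fix e :: real assume "e > 0"
    then obtain N where "N > 0" "inverse (real N) < e\<^sup>2 / 4"
      using reals_Archimedean2[of "4 / e\<^sup>2"] ex_inverse_of_nat_less[of "e\<^sup>2 / 4"] by auto
    then have "4 / real (Suc N) < e\<^sup>2"
      by (simp add: field_simps) (smt (verit) zero_le_power2)
    then have "norm (X i - X j) < e" if "N \<le> i" "N \<le> j" for i j
      using close[OF that] \<open>e > 0\<close> power2_less_imp_less[of "norm (X i - X j)" e] by linarith
    then show "\<exists>M. \<forall>i\<ge>M. \<forall>j\<ge>M. norm (X i - X j) < e" by blast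
  qed
  then obtain u where u: "X \<longlonglongrightarrow> u"
    using Cauchy_convergent convergent_def by blast
  have "(\<lambda>n. J (X n)) \<longlonglongrightarrow> J u"
    unfolding J_def by (intro tendsto_intros bounded_linear.tendsto[OF bl] u)
  moreover have "(\<lambda>n. m + 1 / Suc n) \<longlonglongrightarrow> m + 0"
    by (intro tendsto_intros LIMSEQ_Suc[OF lim_1_over_n])
  ultimately have Ju: "J u \<le> m"
    using X LIMSEQ_le[of "\<lambda>n. J (X n)" "J u" "\<lambda>n. m + 1 / Suc n" "m + 0"]
    by (auto intro: less_imp_le)
  have Re_eq: "Re (f h) = Re (cinner h u)" for h
  proof -
    define b where "b = Re (cinner h u) - Re (f h)"
    have quad: "0 \<le> t\<^sup>2 * (norm h)\<^sup>2 + 2 * t * b" for t :: real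
      using m_le[of "u + t *\<^sub>R h"] Ju cinner_commute[of u h]
      by (simp add: J_def b_def norm_add_power2 linear_simps[OF bl] scaleR_eq_scaleC norm_scaleC
          cinner_simps scale add power_mult_distrib algebra_simps)
    \<comment> \<open>Nearly the minimiser \<open>- b / \<parallel>h\<parallel>\<^sup>2\<close> of the quadratic, but also defined for \<open>h = 0\<close>.\<close>
    define q t where "q = (norm h)\<^sup>2 + 1" and "t = - b / q"
    have "q > 0" by (simp add: q_def add_nonneg_pos)
    then have tq: "t * q = - b" by (simp add: t_def)
    have "0 \<le> q\<^sup>2 * (t\<^sup>2 * (norm h)\<^sup>2 + 2 * t * b)"
      by (intro mult_nonneg_nonneg quad) simp
    also have "\<dots> = (t * q)\<^sup>2 * (norm h)\<^sup>2 + 2 * (t * q) * q * b"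
      by (simp add: algebra_simps power2_eq_square)
    also have "\<dots> = - (b\<^sup>2 * ((norm h)\<^sup>2 + 2))"
      unfolding tq by (simp add: q_def algebra_simps power2_eq_square)
    finally have "b\<^sup>2 * ((norm h)\<^sup>2 + 2) \<le> 0" by simp
    then have "b = 0"
      by (smt (verit) mult_pos_pos zero_le_power2 zero_less_power2)
    then show ?thesis by (simp add: b_def)
  qed
  have "f x = cinner x u" for x
    using Re_eq[of x] Re_eq[of "\<i> *\<^sub>C x"] by (simp add: complex_eq_iff scale cinner_scaleC_left)
  then show ?thesis by blast
qed

lemma cinner_op_adj:
  assumes "bounded_clinear S"
  shows "cinner (S x) y = cinner x (op_adj S y)"
proof -
  have "\<exists>u. \<forall>x. cinner (S x) y = cinner x u" for y
  proof (rule Riesz_representation[where f = "\<lambda>x. cinner (S x) y" and K = "onorm S * norm y"])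
    show "cmod (cinner (S x) y) \<le> (onorm S * norm y) * norm x" for x
      using cinner_Cauchy_Schwarz[of "S x" y]
        mult_right_mono[OF norm_le_onorm[OF assms, of x] norm_ge_zero[of y]]
      by (simp add: mult_ac)
  qed (simp_all add: bounded_clinear_add[OF assms] bounded_clinear_scaleC[OF assms] cinner_simps)
  then obtain S' where S': "\<forall>x y. cinner (S x) y = cinner x (S' y)"
    by metis
  have "\<forall>x y. cinner (S x) y = cinner x (op_adj S y)"
    unfolding op_adj_def
  proof (rule theI[of _ S'])
    show "R = S'" if "\<forall>x y. cinner (S x) y = cinner x (R y)" for R
      using that S' by (intro ext cinner_ext) metis
  qed (rule S')
  then show ?thesis by blast
qed

lemma norm_op_adj_le:
  assumes "bounded_clinear S"
  shows "norm (op_adj S y) \<le> onorm S * norm y"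
proof (cases "op_adj S y = 0")
  case True
  then show ?thesis
    using onorm_pos_le[OF bounded_clinear_bounded_linear[OF assms]] by simp
next
  case False
  have "complex_of_real ((norm (op_adj S y))\<^sup>2) = cinner (S (op_adj S y)) y"
    by (simp add: cinner_op_adj[OF assms] cinner_self)
  then have "(norm (op_adj S y))\<^sup>2 \<le> norm (S (op_adj S y)) * norm y"
    by (metis abs_power2 cinner_Cauchy_Schwarz norm_of_real)
  also have "\<dots> \<le> onorm S * norm (op_adj S y) * norm y"
    by (intro mult_right_mono norm_le_onorm[OF assms]) simp
  finally show ?thesis
    using False by (simp add: power2_eq_square mult.commute mult.left_commute)
qed

section \<open>Orthonormal bases\<close>

text \<open>Truncations of the Fourier expansion are best approximations, hence beat any given
  element of the span as soon as they contain the basis vectors occurring in it.\<close>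

lemma Parseval:
  assumes "orthonormal_basis B"
  shows "((\<lambda>e. cinner x e * cinner e y) has_sum cinner x y) B"
  unfolding has_sum_def tendsto_iff eventually_finite_subsets_at_top
proof (intro allI impI)
  fix \<epsilon> :: real assume "\<epsilon> > 0"
  define \<delta> where "\<delta> = \<epsilon> / (norm y + 1)"
  have "norm y + 1 > 0" by (simp add: add_nonneg_pos)
  then have "\<delta> * (norm y + 1) = \<epsilon>"
    by (simp add: \<delta>_def)
  then have \<delta>: "\<delta> * norm y + \<delta> = \<epsilon>"
    by (simp add: distrib_left)
  have "\<delta> > 0" using \<open>\<epsilon> > 0\<close> \<open>norm y + 1 > 0\<close> by (simp add: \<delta>_def)
  have "x \<in> closure (complex_vector.span B)"
    using assms by (simp add: orthonormal_basis_def)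
  then obtain s where "s \<in> complex_vector.span B" and near: "dist s x < \<delta>"
    using \<open>\<delta> > 0\<close> by (meson closure_approachable)
  then obtain X r where X: "finite X" "X \<subseteq> B" and s: "s = (\<Sum>a\<in>X. r a *\<^sub>C a)"
    unfolding complex_vector.span_explicit by blast
  have "dist (\<Sum>e\<in>Y. cinner x e * cinner e y) (cinner x y) < \<epsilon>"
    if Y: "finite Y" "X \<subseteq> Y" "Y \<subseteq> B" for Y
  proof -
    define p where "p = (\<Sum>e\<in>Y. cinner x e *\<^sub>C e)"
    have ON: "cinner e f = (if e = f then 1 else 0)" if "e \<in> Y" "f \<in> Y" for e f
      using assms that Y unfolding orthonormal_basis_def by blast
    have orth: "cinner (x - p) f = 0" if "f \<in> Y" for f
    proof -
      have "cinner p f = (\<Sum>e\<in>Y. if e = f then cinner x e else 0)"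
        unfolding p_def cinner_sum_left
        by (rule sum.cong) (auto simp: cinner_scaleC_left ON that)
      then show ?thesis
        using that Y by (simp add: cinner_diff_left)
    qed
    have comb: "cinner (x - p) (\<Sum>a\<in>Z. c a *\<^sub>C a) = 0" if "Z \<subseteq> Y" for Z c
      using that by (auto intro!: sum.neutral simp: cinner_sum_right cinner_scaleC_right orth)
    have "cinner (x - p) p = 0" "cinner (x - p) s = 0"
      using comb[of Y "cinner x"] comb[of X r] Y by (simp_all only: p_def [symmetric] s order.refl)
    then have "(norm (x - s))\<^sup>2 = (norm (x - p))\<^sup>2 + (norm (p - s))\<^sup>2"
      using norm_add_power2[of "x - p" "p - s"] by (simp add: cinner_diff_right)
    then have "norm (x - p) \<le> norm (x - s)"
      using power2_le_imp_le[of "norm (x - p)" "norm (x - s)"] by simp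
    also have "\<dots> < \<delta>"
      using near by (simp add: dist_norm norm_minus_commute)
    finally have "norm (x - p) * norm y \<le> \<delta> * norm y"
      by (intro mult_right_mono) auto
    also have "\<dots> < \<epsilon>"
      using \<delta> \<open>\<delta> > 0\<close> by simp
    finally have "cmod (cinner (x - p) y) < \<epsilon>"
      using cinner_Cauchy_Schwarz[of "x - p" y] by linarith
    moreover have "(\<Sum>e\<in>Y. cinner x e * cinner e y) = cinner p y"
      by (simp add: p_def cinner_sum_left cinner_scaleC_left)
    ultimately show ?thesis
      by (simp add: dist_norm norm_minus_commute cinner_diff_left)
  qed
  then show "\<exists>X. finite X \<and> X \<subseteq> B \<and> (\<forall>Y. finite Y \<and> X \<subseteq> Y \<and> Y \<subseteq> B \<longrightarrow>
      dist (\<Sum>e\<in>Y. cinner x e * cinner e y) (cinner x y) < \<epsilon>)"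
    using X by blast
qed

lemma Parseval_norm:
  assumes "orthonormal_basis B"
  shows "((\<lambda>e. (cmod (cinner x e))\<^sup>2) has_sum (norm x)\<^sup>2) B"
  using has_sum_Re[OF Parseval[OF assms, of x x]]
  by (simp add: cinner_self flip: cmod_power2_cinner)

section \<open>States as convex combinations of vector states\<close>

text \<open>If \<open>\<langle>Q e, e\<rangle> = 0\<close>, then \<open>Q e = 0\<close> for positive \<open>Q\<close>, and the convention \<open>1 / 0 = 0\<close> makes the
  pivot vanish as well, so a degenerate elimination step changes nothing.\<close>

definition pivot :: "('a::chilbert_space \<Rightarrow> 'a) \<Rightarrow> 'a \<Rightarrow> 'a" where
  "pivot Q e = complex_of_real (1 / sqrt (Re (cinner (Q e) e))) *\<^sub>C Q e"

text \<open>One step of symmetric Gaussian elimination: the Schur complement of \<open>Q\<close> with respect to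
  the line spanned by \<open>e\<close>.\<close>

definition deflate :: "('a::chilbert_space \<Rightarrow> 'a) \<Rightarrow> 'a \<Rightarrow> 'a \<Rightarrow> 'a" where
  "deflate Q e = (\<lambda>x. Q x - cinner x (pivot Q e) *\<^sub>C pivot Q e)"

primrec residual :: "('a::chilbert_space \<Rightarrow> 'a) \<Rightarrow> (nat \<Rightarrow> 'a) \<Rightarrow> nat \<Rightarrow> 'a \<Rightarrow> 'a" where
  "residual Q e 0 = Q"
| "residual Q e (Suc n) = deflate (residual Q e n) (e n)"

lemma pivot_bound:
  assumes "positive_op Q"
  shows "(cmod (cinner x (pivot Q e)))\<^sup>2 \<le> Re (cinner (Q x) x)"
proof -
  define d where "d = Re (cinner (Q e) e)"
  have nn: "Re (cinner (Q z) z) \<ge> 0" for z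
    using assms by (auto simp: positive_op_def complex_nonneg_Reals_iff)
  have "(cmod (cinner x (pivot Q e)))\<^sup>2 = (cmod (cinner (Q x) e))\<^sup>2 / d"
    using nn[of e] by (simp add: pivot_def d_def cinner_scaleC_right positive_op_selfadjoint[OF assms]
        norm_mult norm_divide power_mult_distrib power_divide)
  also have "\<dots> \<le> Re (cinner (Q x) x)"
    using positive_op_Cauchy_Schwarz[OF assms, of x e] nn[of x] nn[of e]
    by (cases "d = 0") (auto simp: field_simps simp flip: d_def)
  finally show ?thesis .
qed

lemma positive_op_deflate:
  assumes "positive_op Q"
  shows "positive_op (deflate Q e)"
proof -
  have "bounded_clinear (deflate Q e)"
    unfolding deflate_def
    using assms by (intro bounded_clinear_minus bounded_clinear_rank_one) (simp add: positive_op_def)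
  moreover have "cinner (deflate Q e x) x \<in> \<real>\<^sub>\<ge>\<^sub>0" for x
  proof -
    have "cinner (deflate Q e x) x = cinner (Q x) x - complex_of_real ((cmod (cinner x (pivot Q e)))\<^sup>2)"
      by (simp only: deflate_def cinner_diff_left cinner_scaleC_left cmod_power2_cinner)
    then show ?thesis
      using assms pivot_bound[OF assms, of x e] by (auto simp: positive_op_def complex_nonneg_Reals_iff)
  qed
  ultimately show ?thesis by (simp add: positive_op_def)
qed

lemma deflate_self:
  assumes "positive_op Q"
  shows "deflate Q e e = 0"
proof -
  define d where "d = Re (cinner (Q e) e)"
  have d: "cinner (Q e) e = complex_of_real d" and "d \<ge> 0"
    using assms by (auto simp: positive_op_def complex_nonneg_Reals_iff d_def complex_eq_iff)
  show ?thesis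
  proof (cases "d = 0")
    case True
    then show ?thesis
      using positive_op_eq_zero[OF assms, of e] by (simp add: deflate_def pivot_def flip: d_def)
  next
    case False
    then have "cinner e (pivot Q e) * complex_of_real (1 / sqrt d) = 1"
      using \<open>d \<ge> 0\<close> d
      by (simp add: pivot_def cinner_scaleC_right flip: d_def positive_op_selfadjoint[OF assms])
        (metis of_real_eq_0_iff of_real_mult nonzero_eq_divide_eq real_sqrt_mult_self abs_of_nonneg)
    then show ?thesis
      by (simp add: deflate_def) (simp add: pivot_def scaleC_scaleC scaleC_one flip: d_def)
  qed
qed

lemma deflate_kernel:
  assumes "positive_op Q" "Q x = 0"
  shows "deflate Q e x = 0"
  using pivot_bound[OF assms(1), of x e] assms(2) by (simp add: deflate_def)

lemma positive_op_residual: "positive_op Q \<Longrightarrow> positive_op (residual Q e n)"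
  by (induction n) (auto intro: positive_op_deflate)

lemma residual_kernel:
  assumes "positive_op Q" "residual Q e m x = 0" "m \<le> n"
  shows "residual Q e n x = 0"
  using assms(3,2)
  by (induction n rule: dec_induct) (auto intro: deflate_kernel positive_op_residual assms(1))

lemma residual_expansion:
  "Q x = residual Q e n x +
    (\<Sum>k<n. cinner x (pivot (residual Q e k) (e k)) *\<^sub>C pivot (residual Q e k) (e k))"
  by (induction n) (auto simp: deflate_def)

text \<open>Symmetric Gaussian elimination (Cholesky) along the basis vectors that \<open>P\<close> does not
  annihilate produces vectors \<open>v n\<close> with \<open>P = (\<Sum>n. |v n\<rangle>\<langle>v n|)\<close>.  Only countably many basis vectors
  are involved because the diagonal of \<open>P\<close> is summable, and applied to a basis vector the expansion
  is a finite sum, because elimination along a vector annihilates it for good.  The masses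
  \<open>\<parallel>v n\<parallel>\<^sup>2\<close> add up to at most the trace of \<open>P\<close>, which makes the double series of the
  products \<open>\<langle>S e, v n\<rangle> \<langle>v n, e\<rangle>\<close> absolutely summable; exchanging the two summations turns the trace of \<open>P S\<close> into a sum of vector
  functionals.\<close>

theorem trace_as_vector_states:
  assumes P: "positive_op P" and B: "orthonormal_basis B"
    and summable: "(\<lambda>e. cinner (P e) e) summable_on B"
  shows "\<exists>v :: nat \<Rightarrow> 'a::chilbert_space. \<forall>S. bounded_clinear S \<longrightarrow>
           ((\<lambda>n. cinner (S (v n)) (v n)) has_sum (\<Sum>\<^sub>\<infinity>e\<in>B. cinner (P (S e)) e)) UNIV"
proof -
  define D where "D = {e \<in> B. cinner (P e) e \<noteq> 0}"
  have countable: "countable D"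
    unfolding D_def by (rule summable_countable_complex[OF summable])
  define v where "v n = pivot (residual P (from_nat_into D) n) (from_nat_into D n)" for n
  let ?R = "residual P (from_nat_into D)"
  have R: "positive_op (?R n)" for n
    by (rule positive_op_residual[OF P])
  have vanish: "\<exists>m. ?R m x = 0" if "x \<in> B" for x
  proof (cases "x \<in> D")
    case True
    then obtain k where "from_nat_into D k = x"
      using countable from_nat_into_surj by metis
    then have "?R (Suc k) x = 0"
      using deflate_self[OF R] by auto
    then show ?thesis by blast
  next
    case False
    then have "?R 0 x = 0"
      using that by (auto simp: D_def intro: positive_op_eq_zero[OF P])
    then show ?thesis by blast
  qed
  have expansion: "((\<lambda>n. cinner y (v n) * cinner (v n) x) has_sum cinner y (P x)) UNIV"
    if x: "x \<in> B" for x y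
  proof -
    obtain m where m: "?R m x = 0" using vanish[OF x] by blast
    have "cinner x (v n) = 0" if "n \<ge> m" for n
      using pivot_bound[OF R, of x n "from_nat_into D n"] residual_kernel[OF P m that]
      by (simp add: v_def)
    then have zero: "cinner (v n) x = 0" if "n \<ge> m" for n
      using that cinner_commute[of "v n" x] by simp
    have "cinner y (P x) = (\<Sum>n<m. cinner y (v n) * cinner (v n) x)"
      unfolding residual_expansion[of P x "from_nat_into D" m] m v_def[symmetric]
      by (simp add: cinner_sum_right cinner_scaleC_right mult.commute flip: cinner_commute)
    then show ?thesis
      by (intro has_sum_finite_neutralI[where B = "{..<m}"]) (auto simp: zero not_less)
  qed
  have diagonal: "((\<lambda>n. (cmod (cinner (v n) x))\<^sup>2) has_sum Re (cinner (P x) x)) UNIV" if "x \<in> B" for x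
    using has_sum_Re[OF expansion[OF that, of x]]
    by (simp add: positive_op_selfadjoint[OF P] cmod_cinner_commute[of _ x] flip: cmod_power2_cinner)
  have summable_norm: "(\<lambda>n. (norm (v n))\<^sup>2) summable_on UNIV"
  proof (rule nonneg_bdd_above_summable_on)
    show "bdd_above (sum (\<lambda>n. (norm (v n))\<^sup>2) ` {F. F \<subseteq> UNIV \<and> finite F})"
    proof (rule bdd_aboveI2)
      fix F :: "nat set" assume "F \<in> {F. F \<subseteq> UNIV \<and> finite F}"
      then have F: "finite F" by simp
      have "((\<lambda>e. \<Sum>n\<in>F. (cmod (cinner (v n) e))\<^sup>2) has_sum (\<Sum>n\<in>F. (norm (v n))\<^sup>2)) B"
        using F by (induction F) (auto intro!: has_sum_0 has_sum_add Parseval_norm B)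
      moreover have "((\<lambda>e. Re (cinner (P e) e)) has_sum Re (\<Sum>\<^sub>\<infinity>e\<in>B. cinner (P e) e)) B"
        by (intro has_sum_Re has_sum_infsum summable)
      ultimately show "(\<Sum>n\<in>F. (norm (v n))\<^sup>2) \<le> Re (\<Sum>\<^sub>\<infinity>e\<in>B. cinner (P e) e)"
        by (rule has_sum_mono) (auto intro!: finite_sum_le_has_sum[OF diagonal] F)
    qed
  qed simp
  have "((\<lambda>n. cinner (S (v n)) (v n)) has_sum (\<Sum>\<^sub>\<infinity>e\<in>B. cinner (P (S e)) e)) UNIV"
    if S: "bounded_clinear S" for S
  proof -
    define f where "f n e = cinner (S e) (v n) * cinner (v n) e" for n e
    define w where "w n = op_adj S (v n)" for n
    \<comment> \<open>The majorant comes from \<open>2 a b \<le> a\<^sup>2 + b\<^sup>2\<close>; its total mass is estimated by Parseval.\<close>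
    have f_bound: "norm (f n e) \<le> (cmod (cinner (w n) e))\<^sup>2 + (cmod (cinner (v n) e))\<^sup>2" for n e
    proof -
      have "cmod (cinner (S e) (v n)) = cmod (cinner (w n) e)"
        by (metis cinner_commute cinner_op_adj[OF S] complex_mod_cnj w_def)
      moreover have "a * b \<le> a\<^sup>2 + b\<^sup>2" if "a \<ge> 0" "b \<ge> 0" for a b :: real
        using sum_squares_bound[of a b] mult_nonneg_nonneg[OF that] by linarith
      ultimately show ?thesis
        by (simp add: f_def norm_mult)
    qed
    have major: "((\<lambda>e. (cmod (cinner (w n) e))\<^sup>2 + (cmod (cinner (v n) e))\<^sup>2)
        has_sum (norm (w n))\<^sup>2 + (norm (v n))\<^sup>2) B" for n
      by (intro has_sum_add Parseval_norm B)
    have f_abs: "(\<lambda>e. norm (f n e)) summable_on B" for n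
      using f_bound
      by (intro summable_on_comparison_test[OF has_sum_imp_summable[OF major[of n]]]) auto
    have f_infsum: "(\<Sum>\<^sub>\<infinity>e\<in>B. norm (f n e)) \<le> ((onorm S)\<^sup>2 + 1) * (norm (v n))\<^sup>2" for n
    proof -
      have "(\<Sum>\<^sub>\<infinity>e\<in>B. norm (f n e)) \<le> (norm (w n))\<^sup>2 + (norm (v n))\<^sup>2"
        by (rule has_sum_mono[OF has_sum_infsum[OF f_abs] major f_bound])
      moreover have "(norm (w n))\<^sup>2 \<le> (onorm S * norm (v n))\<^sup>2"
        unfolding w_def by (intro power_mono norm_op_adj_le S) simp
      ultimately show ?thesis
        by (simp add: power_mult_distrib algebra_simps)
    qed
    have "(\<lambda>n. \<Sum>\<^sub>\<infinity>e\<in>B. norm (f n e)) summable_on UNIV"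
      by (rule summable_on_comparison_test[OF summable_on_cmult_right[OF summable_norm] f_infsum])
        (auto intro: infsum_nonneg)
    then have "(\<lambda>p. norm (case p of (n, e) \<Rightarrow> f n e)) summable_on UNIV \<times> B"
      unfolding Infinite_Sum.abs_summable_on_Sigma_iff using f_abs by (simp add: infsum_nonneg)
    then have prod: "(\<lambda>(n, e). f n e) summable_on UNIV \<times> B"
      by (rule Infinite_Sum.abs_summable_summable)
    have inner: "infsum (f n) B = cinner (S (v n)) (v n)" for n
    proof (rule infsumI)
      have "((\<lambda>e. cinner (v n) e * cinner e (w n)) has_sum cinner (v n) (w n)) B"
        by (rule Parseval[OF B])
      then show "(f n has_sum cinner (S (v n)) (v n)) B"
        by (simp add: f_def[abs_def] w_def mult.commute flip: cinner_op_adj[OF S])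
    qed
    have outer: "(\<Sum>\<^sub>\<infinity>n. f n e) = cinner (P (S e)) e" if "e \<in> B" for e
      unfolding positive_op_selfadjoint[OF P] f_def by (rule infsumI[OF expansion[OF that]])
    have "(\<lambda>n. infsum (f n) B) summable_on UNIV"
      using summable_on_Sigma_banach[OF prod] by simp
    then have "((\<lambda>n. infsum (f n) B) has_sum (\<Sum>\<^sub>\<infinity>n. infsum (f n) B)) UNIV"
      by (rule has_sum_infsum)
    moreover have "(\<Sum>\<^sub>\<infinity>n. infsum (f n) B) = (\<Sum>\<^sub>\<infinity>e\<in>B. \<Sum>\<^sub>\<infinity>n. f n e)"
      by (rule infsum_swap_banach[OF prod])
    moreover have "\<dots> = (\<Sum>\<^sub>\<infinity>e\<in>B. cinner (P (S e)) e)"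
      by (intro infsum_cong outer)
    ultimately show ?thesis
      by (simp add: inner)
  qed
  then show ?thesis by blast
qed

section \<open>The covariance of two operators in a state\<close>

text \<open>The covariance is \<open>\<Sum>n. \<langle>(T - t) v n, S* v n\<rangle>\<close>; Cauchy-Schwarz bounds it by
  the product of \<open>\<parallel>S\<parallel>\<close> and the standard deviation of \<open>T\<close>, which is at most \<open>\<parallel>T\<parallel>\<close>.\<close>

lemma covariance_bound:
  fixes v :: "nat \<Rightarrow> 'a::chilbert_space"
  assumes S: "bounded_clinear S" and T: "bounded_clinear T"
    and one: "((\<lambda>n. cinner (v n) (v n)) has_sum 1) UNIV"
    and s: "((\<lambda>n. cinner (S (v n)) (v n)) has_sum s) UNIV"
    and t: "((\<lambda>n. cinner (T (v n)) (v n)) has_sum t) UNIV"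
    and st: "((\<lambda>n. cinner (S (T (v n))) (v n)) has_sum st) UNIV"
  shows "cmod (st - s * t) \<le> onorm S * onorm T"
proof -
  define w where "w n = T (v n) - t *\<^sub>C v n" for n
  define u where "u n = op_adj S (v n)" for n
  define g where "g n = (onorm T)\<^sup>2 * (norm (v n))\<^sup>2 +
    (-2) * Re (cnj t * cinner (T (v n)) (v n)) + (cmod t)\<^sup>2 * (norm (v n))\<^sup>2" for n
  have pos: "onorm S \<ge> 0" "onorm T \<ge> 0"
    using S T by (auto intro: onorm_pos_le bounded_clinear_bounded_linear)
  have norm1: "((\<lambda>n. (norm (v n))\<^sup>2) has_sum 1) UNIV"
    using has_sum_Re[OF one] by (simp add: Re_cinner_self)
  have cov: "((\<lambda>n. cinner (w n) (u n)) has_sum (st - s * t)) UNIV"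
  proof -
    have "((\<lambda>n. cinner (S (T (v n))) (v n) + (- t) * cinner (S (v n)) (v n)) has_sum
        (st + (- t) * s)) UNIV"
      by (intro has_sum_add has_sum_cmult_right s st)
    then show ?thesis
      by (simp add: w_def u_def bounded_clinear_diff[OF S] bounded_clinear_scaleC[OF S]
          cinner_diff_left cinner_scaleC_left mult.commute flip: cinner_op_adj[OF S])
  qed
  have g_ge: "(norm (w n))\<^sup>2 \<le> g n" for n
  proof -
    have "(norm (T (v n)))\<^sup>2 \<le> (onorm T * norm (v n))\<^sup>2"
      by (intro power_mono norm_le_onorm T) simp
    then show ?thesis
      unfolding w_def g_def norm_diff_power2
      by (simp add: norm_scaleC power_mult_distrib cinner_scaleC_right)
  qed
  have "(g has_sum ((onorm T)\<^sup>2 * 1 + (-2) * Re (cnj t * t) + (cmod t)\<^sup>2 * 1)) UNIV"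
    unfolding g_def by (intro has_sum_add has_sum_cmult_right has_sum_Re norm1 t)
  moreover have "(onorm T)\<^sup>2 * 1 + (-2) * Re (cnj t * t) + (cmod t)\<^sup>2 * 1 = (onorm T)\<^sup>2 - (cmod t)\<^sup>2"
    unfolding cmod_power2 by (simp add: power2_eq_square)
  ultimately have g_sum: "(g has_sum ((onorm T)\<^sup>2 - (cmod t)\<^sup>2)) UNIV"
    by (simp only:)
  have w_bound: "(\<Sum>n\<in>F. (norm (w n))\<^sup>2) \<le> (onorm T)\<^sup>2" if "finite F" for F
  proof -
    have "(\<Sum>n\<in>F. (norm (w n))\<^sup>2) \<le> sum g F"
      by (intro sum_mono g_ge)
    also have "\<dots> \<le> (onorm T)\<^sup>2 - (cmod t)\<^sup>2"
      using g_ge by (intro finite_sum_le_has_sum[OF g_sum that]) (auto intro: order.trans[OF zero_le_power2])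
    finally show ?thesis
      by (smt (verit) zero_le_power2)
  qed
  have u_bound: "(\<Sum>n\<in>F. (norm (u n))\<^sup>2) \<le> (onorm S)\<^sup>2" if "finite F" for F
  proof -
    have "(\<Sum>n\<in>F. (norm (u n))\<^sup>2) \<le> (\<Sum>n\<in>F. (onorm S)\<^sup>2 * (norm (v n))\<^sup>2)"
      unfolding u_def power_mult_distrib[symmetric]
      by (intro sum_mono power_mono norm_op_adj_le S) simp
    also have "\<dots> = (onorm S)\<^sup>2 * (\<Sum>n\<in>F. (norm (v n))\<^sup>2)"
      by (simp add: sum_distrib_left)
    also have "\<dots> \<le> (onorm S)\<^sup>2 * 1"
      by (intro mult_left_mono finite_sum_le_has_sum[OF norm1 that]) auto
    finally show ?thesis by simp
  qed
  have "norm (\<Sum>n\<in>F. cinner (w n) (u n)) \<le> onorm S * onorm T" if F: "finite F" for F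
  proof -
    have "norm (\<Sum>n\<in>F. cinner (w n) (u n)) \<le> (\<Sum>n\<in>F. norm (cinner (w n) (u n)))"
      by (rule norm_sum)
    also have "\<dots> \<le> (\<Sum>n\<in>F. \<bar>norm (w n)\<bar> * \<bar>norm (u n)\<bar>)"
      by (intro sum_mono) (simp add: cinner_Cauchy_Schwarz)
    also have "\<dots> \<le> L2_set (\<lambda>n. norm (w n)) F * L2_set (\<lambda>n. norm (u n)) F"
      by (rule L2_set_mult_ineq)
    also have "\<dots> \<le> onorm T * onorm S"
      unfolding L2_set_def using w_bound[OF F] u_bound[OF F] pos
      by (intro mult_mono real_le_lsqrt real_sqrt_ge_zero sum_nonneg) auto
    finally show ?thesis by (simp add: mult.commute)
  qed
  then show ?thesis
    using cov unfolding has_sum_def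
    by (intro tendsto_upperbound[OF tendsto_norm]) auto
qed

section \<open>Numerical radius and distance to the scalars\<close>

lemma onorm_le_of_unit_bound:
  fixes S :: "'a::chilbert_space \<Rightarrow> 'a"
  assumes "bounded_clinear S" "r \<ge> 0" "\<And>x. norm x = 1 \<Longrightarrow> norm (S x) \<le> r"
  shows "onorm S \<le> r"
proof (rule onorm_bound[OF assms(2)])
  fix x
  show "norm (S x) \<le> r * norm x"
  proof (cases "x = 0")
    case True
    then show ?thesis by (simp add: bounded_clinear_zero[OF assms(1)])
  next
    case False
    have "norm (S (complex_of_real (1 / norm x) *\<^sub>C x)) \<le> r"
      using False by (intro assms(3)) (simp add: norm_scaleC norm_divide)
    then show ?thesis
      using False
      by (simp add: bounded_clinear_scaleC[OF assms(1)] norm_scaleC norm_divide field_simps)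
  qed
qed

lemma numerical_radius_upper:
  assumes "bounded_clinear S"
  shows "cmod (cinner (S x) x) \<le> numerical_radius S * (norm x)\<^sup>2"
proof (cases "x = 0")
  case False
  have "cmod (cinner (S h) h) \<le> onorm S" if "norm h = 1" for h
    using cinner_Cauchy_Schwarz[of "S h" h] norm_le_onorm[OF assms, of h] that by simp
  then have bdd: "bdd_above (cmod ` numerical_range S)"
    unfolding numerical_range_def by (auto intro!: bdd_aboveI[where M = "onorm S"])
  define h where "h = complex_of_real (1 / norm x) *\<^sub>C x"
  have "norm h = 1"
    using False by (simp add: h_def norm_scaleC norm_divide)
  then have "cmod (cinner (S h) h) \<le> numerical_radius S"
    unfolding numerical_radius_def
    by (intro cSUP_upper bdd) (auto simp: numerical_range_def)
  then show ?thesis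
    using False by (simp add: h_def bounded_clinear_scaleC[OF assms] cinner_simps norm_mult
        norm_divide field_simps power2_eq_square)
qed (simp add: bounded_clinear_zero[OF assms])

text \<open>Polarisation expresses \<open>\<langle>S x, y\<rangle>\<close> by four values of the quadratic form; the parallelogram
  law turns the resulting bound into \<open>w(S) (\<parallel>x\<parallel>\<^sup>2 + \<parallel>y\<parallel>\<^sup>2)\<close>.\<close>

lemma onorm_le_numerical_radius:
  fixes S :: "'a::chilbert_space \<Rightarrow> 'a"
  assumes S: "bounded_clinear S" and unit: "\<exists>x :: 'a. norm x = 1"
  shows "0 \<le> numerical_radius S" and "onorm S \<le> 2 * numerical_radius S"
proof -
  let ?w = "numerical_radius S"
  let ?q = "\<lambda>x. cinner (S x) x"
  show nonneg: "0 \<le> ?w"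
    using unit numerical_radius_upper[OF S] by (metis mult.right_neutral norm_ge_zero order.trans power_one)
  have bound: "cmod (cinner (S x) y) \<le> ?w * ((norm x)\<^sup>2 + (norm y)\<^sup>2)" for x y
  proof -
    have "4 * cinner (S x) y = (?q (x + y) - ?q (x - y)) +
        (\<i> * ?q (x + \<i> *\<^sub>C y) - \<i> * ?q (x - \<i> *\<^sub>C y))"
      by (simp add: bounded_clinear_add[OF S] bounded_clinear_diff[OF S]
          bounded_clinear_scaleC[OF S] cinner_simps algebra_simps)
    then have "4 * cmod (cinner (S x) y) = cmod ((?q (x + y) - ?q (x - y)) +
        (\<i> * ?q (x + \<i> *\<^sub>C y) - \<i> * ?q (x - \<i> *\<^sub>C y)))"
      by (metis norm_mult norm_numeral)
    also have "\<dots> \<le> (cmod (?q (x + y)) + cmod (?q (x - y))) +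
        (cmod (\<i> * ?q (x + \<i> *\<^sub>C y)) + cmod (\<i> * ?q (x - \<i> *\<^sub>C y)))"
      by (intro norm_triangle_mono norm_triangle_ineq4)
    also have "\<dots> \<le> (?w * (norm (x + y))\<^sup>2 + ?w * (norm (x - y))\<^sup>2) +
        (?w * (norm (x + \<i> *\<^sub>C y))\<^sup>2 + ?w * (norm (x - \<i> *\<^sub>C y))\<^sup>2)"
      unfolding norm_mult norm_ii mult_1_left by (intro add_mono numerical_radius_upper S)
    also have "\<dots> = 4 * (?w * ((norm x)\<^sup>2 + (norm y)\<^sup>2))"
      by (simp add: norm_add_power2 norm_diff_power2 norm_scaleC algebra_simps)
    finally show ?thesis by simp
  qed
  show "onorm S \<le> 2 * ?w"
  proof (rule onorm_le_of_unit_bound[OF S])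
    fix x :: 'a assume x: "norm x = 1"
    show "norm (S x) \<le> 2 * ?w"
    proof (cases "S x = 0")
      case True
      then show ?thesis using nonneg by simp
    next
      case False
      define y where "y = complex_of_real (1 / norm (S x)) *\<^sub>C S x"
      have "norm y = 1" "cmod (cinner (S x) y) = norm (S x)"
        using False by (simp_all add: y_def norm_scaleC norm_divide norm_mult cinner_scaleC_right
            cinner_self norm_power power2_eq_square)
      then show ?thesis using bound[of x y] x by simp
    qed
  qed (use nonneg in simp)
qed

lemma numerical_radius_shift_le:
  fixes S :: "'a::chilbert_space \<Rightarrow> 'a"
  assumes "numerical_range S \<subseteq> cball z r" and "\<exists>x :: 'a. norm x = 1"
  shows "numerical_radius (shift_op S z) \<le> r"
  unfolding numerical_radius_def
proof (rule cSUP_least)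
  show "numerical_range (shift_op S z) \<noteq> {}"
    using assms(2) by (auto simp: numerical_range_def)
  show "cmod w \<le> r" if w: "w \<in> numerical_range (shift_op S z)" for w
  proof -
    obtain h where "norm h = 1" "w = cinner (shift_op S z h) h"
      using w unfolding numerical_range_def by blast
    then have h: "norm h = 1" "w = cinner (S h) h - z"
      by (simp_all add: shift_op_def cinner_simps cinner_self)
    then have "cinner (S h) h \<in> cball z r"
      using assms(1) by (auto simp: numerical_range_def)
    then show ?thesis
      by (simp add: h dist_norm norm_minus_commute)
  qed
qed

lemma onorm_shift_Lipschitz:
  assumes "bounded_clinear S"
  shows "onorm (shift_op S z) \<le> onorm (shift_op S w) + cmod (z - w)"
proof (rule onorm_bound)
  show "0 \<le> onorm (shift_op S w) + cmod (z - w)"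
    using assms by (intro add_nonneg_nonneg onorm_pos_le bounded_clinear_bounded_linear
        bounded_clinear_shift) auto
next
  fix x
  have "shift_op S z x = shift_op S w x - (z - w) *\<^sub>C x"
    by (simp add: shift_op_def complex_vector.scale_left_diff_distrib)
  then have "norm (shift_op S z x) \<le> norm (shift_op S w x) + norm ((z - w) *\<^sub>C x)"
    by (simp only: norm_triangle_ineq4)
  then show "norm (shift_op S z x) \<le> (onorm (shift_op S w) + cmod (z - w)) * norm x"
    using norm_le_onorm[OF bounded_clinear_shift[OF assms], of w x]
    by (simp add: norm_scaleC distrib_right)
qed

text \<open>The infimum in the distance is a minimum, because \<open>z \<mapsto> \<parallel>S - z\<parallel>\<close> is continuous and
  exceeds its value at \<open>0\<close> outside the disc of radius \<open>2 \<parallel>S\<parallel>\<close>.\<close>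

lemma dist_scalars_attained:
  fixes S :: "'a::chilbert_space \<Rightarrow> 'a"
  assumes S: "bounded_clinear S" and unit: "\<exists>x :: 'a. norm x = 1"
  obtains c where "dist_scalars S = onorm (shift_op S c)"
    and "\<And>z. onorm (shift_op S c) \<le> onorm (shift_op S z)"
proof -
  have "1-lipschitz_on UNIV (\<lambda>z. onorm (shift_op S z))"
  proof (rule lipschitz_onI)
    show "dist (onorm (shift_op S z)) (onorm (shift_op S w)) \<le> 1 * dist z w" for z w
      using onorm_shift_Lipschitz[OF S, of z w] onorm_shift_Lipschitz[OF S, of w z]
      by (simp add: dist_real_def dist_norm abs_le_iff norm_minus_commute)
  qed simp
  then have cont: "continuous_on (cball 0 (2 * onorm S)) (\<lambda>z. onorm (shift_op S z))"
    by (meson continuous_on_subset lipschitz_on_continuous_on subset_UNIV)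
  have pos: "onorm S \<ge> 0"
    using S by (auto intro: onorm_pos_le bounded_clinear_bounded_linear)
  have zero: "shift_op S 0 = S"
    by (simp add: shift_op_def)
  obtain c where c: "\<forall>z\<in>cball 0 (2 * onorm S). onorm (shift_op S c) \<le> onorm (shift_op S z)"
    using continuous_attains_inf[OF compact_cball _ cont] pos by force
  have min: "onorm (shift_op S c) \<le> onorm (shift_op S z)" for z
  proof (cases "z \<in> cball 0 (2 * onorm S)")
    case False
    obtain x :: 'a where x: "norm x = 1" using unit by blast
    have "z *\<^sub>C x = S x - shift_op S z x"
      by (simp add: shift_op_def)
    then have "norm (z *\<^sub>C x) \<le> norm (S x) + norm (shift_op S z x)"
      by (simp only: norm_triangle_ineq4)
    then have "cmod z \<le> onorm S + onorm (shift_op S z)"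
      using norm_le_onorm[OF S, of x] norm_le_onorm[OF bounded_clinear_shift[OF S], of z x] x
      by (simp add: norm_scaleC)
    moreover have "onorm (shift_op S c) \<le> onorm S"
      using bspec[OF c, of 0] pos zero by simp
    ultimately show ?thesis using False by simp
  qed (use c in blast)
  then have "dist_scalars S = onorm (shift_op S c)"
    unfolding dist_scalars_def by (intro cInf_eq_minimum) auto
  then show thesis using that min by blast
qed

section \<open>The spectrum of a normal operator\<close>

text \<open>Neumann's theorem in fixed point form: \<open>S x - \<mu> x = y\<close> says that \<open>x\<close> is a fixed point of
  the contraction \<open>x \<mapsto> (S x - y) / \<mu>\<close>.\<close>

lemma op_invertible_shift_if_large:
  fixes S :: "'a::chilbert_space \<Rightarrow> 'a"
  assumes S: "bounded_clinear S" and large: "onorm S < cmod \<mu>"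
  shows "op_invertible (shift_op S \<mu>)"
proof -
  have lin: "bounded_clinear (shift_op S \<mu>)"
    by (rule bounded_clinear_shift[OF S])
  have pos: "onorm S \<ge> 0"
    using S by (auto intro: onorm_pos_le bounded_clinear_bounded_linear)
  then have "\<mu> \<noteq> 0" using large by auto
  have "\<exists>!x. shift_op S \<mu> x = y" for y
  proof -
    have "(1 / \<mu>) *\<^sub>C (S x - y) = x \<longleftrightarrow> shift_op S \<mu> x = y" for x
    proof -
      have "(1 / \<mu>) *\<^sub>C (S x - y) = x \<longleftrightarrow> S x - y = \<mu> *\<^sub>C x"
        using \<open>\<mu> \<noteq> 0\<close> by (metis complex_vector.scale_cancel_left divide_self_if divide_eq_0_iff
            nonzero_mult_div_cancel_left scaleC_one scaleC_scaleC times_divide_eq_right zero_neq_one mult.right_neutral)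
      then show ?thesis by (auto simp: shift_op_def algebra_simps)
    qed
    moreover have "\<exists>!x. (1 / \<mu>) *\<^sub>C (S x - y) = x"
    proof (rule banach_fix_type)
      show "0 \<le> onorm S / cmod \<mu>" "onorm S / cmod \<mu> < 1"
        using pos large by (auto simp: divide_less_eq)
      show "\<forall>x z. dist ((1 / \<mu>) *\<^sub>C (S x - y)) ((1 / \<mu>) *\<^sub>C (S z - y))
          \<le> onorm S / cmod \<mu> * dist x z"
      proof (intro allI)
        fix x z
        have "(1 / \<mu>) *\<^sub>C (S x - y) - (1 / \<mu>) *\<^sub>C (S z - y) = (1 / \<mu>) *\<^sub>C S (x - z)"
          by (simp add: bounded_clinear_diff[OF S] flip: complex_vector.scale_right_diff_distrib)
        then show "dist ((1 / \<mu>) *\<^sub>C (S x - y)) ((1 / \<mu>) *\<^sub>C (S z - y))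
          \<le> onorm S / cmod \<mu> * dist x z"
          using norm_le_onorm[OF S, of "x - z"]
          by (simp add: dist_norm norm_scaleC norm_divide divide_right_mono)
      qed
    qed
    ultimately show ?thesis by simp
  qed
  then obtain R where R: "shift_op S \<mu> (R y) = y" and inj: "shift_op S \<mu> x = shift_op S \<mu> z \<Longrightarrow> x = z" for x y z
    by metis
  have "bounded_linear R"
  proof (rule bounded_linear_intro)
    show "R (x + y) = R x + R y" for x y
      by (rule inj) (simp add: bounded_clinear_add[OF lin] R)
    show "R (r *\<^sub>R x) = r *\<^sub>R R x" for r x
      by (rule inj) (simp add: scaleR_eq_scaleC bounded_clinear_scaleC[OF lin] R)
    show "norm (R y) \<le> norm y * (1 / (cmod \<mu> - onorm S))" for y
    proof -
      have "\<mu> *\<^sub>C R y = S (R y) - y"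
        using R[of y] by (simp add: shift_op_def algebra_simps)
      then have "norm (\<mu> *\<^sub>C R y) \<le> norm (S (R y)) + norm y"
        by (simp only: norm_triangle_ineq4)
      then have "(cmod \<mu> - onorm S) * norm (R y) \<le> norm y"
        using norm_le_onorm[OF S, of "R y"] by (simp add: norm_scaleC left_diff_distrib)
      then show ?thesis
        using large by (simp add: field_simps)
    qed
  qed
  moreover have "R (z *\<^sub>C x) = z *\<^sub>C R x" for z x
    by (rule inj) (simp add: bounded_clinear_scaleC[OF lin] R)
  ultimately have "bounded_clinear R"
    by (simp add: bounded_clinear_def)
  moreover have "R \<circ> shift_op S \<mu> = id" "shift_op S \<mu> \<circ> R = id"
    by (auto simp: fun_eq_iff R intro: inj)
  ultimately show ?thesis
    unfolding op_invertible_def by blast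
qed

lemma shift_op_shift_op: "shift_op (shift_op S z) w = shift_op S (z + w)"
  by (simp add: shift_op_def fun_eq_iff scaleC_add_left)

text \<open>Subtracting \<open>z\<close> from \<open>S\<close> translates the spectrum, so Neumann's theorem applies around any
  centre.\<close>

lemma op_spectrum_subset_cball:
  assumes "bounded_clinear S"
  shows "op_spectrum S \<subseteq> cball z (onorm (shift_op S z))"
proof
  fix \<mu> assume "\<mu> \<in> op_spectrum S"
  then have "\<not> onorm (shift_op S z) < cmod (\<mu> - z)"
    using op_invertible_shift_if_large[OF bounded_clinear_shift[OF assms, of z], of "\<mu> - z"]
    by (auto simp: op_spectrum_def shift_op_shift_op)
  then show "\<mu> \<in> cball z (onorm (shift_op S z))"
    by (simp add: dist_norm norm_minus_commute)
qed

lemma op_invertible_bounded_below: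
  assumes "op_invertible S"
  shows "\<exists>c>0. \<forall>x. c * norm x \<le> norm (S x)"
proof -
  obtain R where R: "bounded_clinear R" "R \<circ> S = id"
    using assms by (auto simp: op_invertible_def)
  obtain K where K: "K > 0" "\<And>x. norm (R x) \<le> norm x * K"
    using bounded_linear.pos_bounded[OF bounded_clinear_bounded_linear[OF R(1)]] by blast
  have "1 / K * norm x \<le> norm (S x)" for x
    using K(2)[of "S x"] K(1) R(2) by (simp add: fun_eq_iff field_simps)
  then show ?thesis
    using K(1) by (intro exI[of _ "1 / K"]) auto
qed

text \<open>A lower bound \<open>c\<close> for \<open>S - \<mu>\<close> yields the lower bound \<open>c / 2\<close> on the disc of radius \<open>c / 2\<close> around
  \<open>\<mu>\<close>; finitely many such discs cover a compact set.\<close>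

lemma uniformly_bounded_below:
  assumes "compact K" and disjoint: "K \<inter> op_spectrum S = {}"
  shows "\<exists>c>0. \<forall>\<mu>\<in>K. \<forall>x. c * norm x \<le> norm (shift_op S \<mu> x)"
proof -
  have "\<forall>\<mu>\<in>K. \<exists>c>0. \<forall>x. c * norm x \<le> norm (shift_op S \<mu> x)"
    using disjoint by (intro ballI op_invertible_bounded_below) (auto simp: op_spectrum_def)
  then obtain c where c: "\<And>\<mu>. \<mu> \<in> K \<Longrightarrow> c \<mu> > 0"
      "\<And>\<mu> x. \<mu> \<in> K \<Longrightarrow> c \<mu> * norm x \<le> norm (shift_op S \<mu> x)"
    by metis
  have "K \<subseteq> (\<Union>\<mu>\<in>K. ball \<mu> (c \<mu> / 2))"
    using c(1) by fastforce
  then obtain F where F: "F \<subseteq> K" "finite F" "K \<subseteq> (\<Union>\<mu>\<in>F. ball \<mu> (c \<mu> / 2))"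
    using compactE_image[OF \<open>compact K\<close>, of K "\<lambda>\<mu>. ball \<mu> (c \<mu> / 2)"] by auto
  define d where "d = Min (insert 1 ((\<lambda>\<mu>. c \<mu> / 2) ` F))"
  have d_le: "d \<le> c \<mu> / 2" if "\<mu> \<in> F" for \<mu>
    unfolding d_def using that F(2) by (intro Min_le) auto
  have "d > 0"
    using F c(1) by (auto simp: d_def)
  moreover have "d * norm x \<le> norm (shift_op S \<mu> x)" if "\<mu> \<in> K" for \<mu> x
  proof -
    obtain \<nu> where \<nu>: "\<nu> \<in> F" "dist \<nu> \<mu> < c \<nu> / 2"
      using F(3) \<open>\<mu> \<in> K\<close> by auto
    have "shift_op S \<nu> x = shift_op S \<mu> x - (\<nu> - \<mu>) *\<^sub>C x"
      by (simp add: shift_op_def complex_vector.scale_left_diff_distrib)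
    then have "norm (shift_op S \<nu> x) \<le> norm (shift_op S \<mu> x) + norm ((\<nu> - \<mu>) *\<^sub>C x)"
      by (simp only: norm_triangle_ineq4)
    moreover have "norm ((\<nu> - \<mu>) *\<^sub>C x) \<le> c \<nu> / 2 * norm x"
      unfolding norm_scaleC using \<nu>(2) by (intro mult_right_mono) (auto simp: dist_norm)
    moreover have "c \<nu> * norm x \<le> norm (shift_op S \<nu> x)"
      using F(1) \<nu>(1) c(2) by blast
    moreover have "d * norm x \<le> c \<nu> / 2 * norm x"
      by (intro mult_right_mono d_le \<nu>) simp
    ultimately show ?thesis by simp
  qed
  ultimately show ?thesis by blast
qed

text \<open>The symmetry \<open>\<omega> j ^ k = \<omega> k ^ j\<close> turns the sum into a geometric one whose ratio
  \<open>\<omega> k / \<omega> l\<close> is an \<open>n\<close>-th root of unity, different from \<open>1\<close> if \<open>k \<noteq> l\<close>.\<close>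

lemma roots_of_unity_orthogonality:
  fixes n k l :: nat
  defines "\<omega> \<equiv> \<lambda>j :: nat. cis (2 * pi * real j / real n)"
  assumes "k < n" "l < n"
  shows "(\<Sum>j<n. \<omega> j ^ k * cnj (\<omega> j ^ l)) = (if k = l then of_nat n else 0)"
proof -
  have swap: "\<omega> j ^ k = \<omega> k ^ j" for j k
  proof -
    have "real k * (2 * pi * real j / real n) = real j * (2 * pi * real k / real n)"
      by simp
    then show ?thesis by (simp only: \<omega>_def Complex.DeMoivre)
  qed
  have unit: "\<omega> j * cnj (\<omega> j) = 1" for j
    by (simp add: \<omega>_def cis_cnj cis_mult)
  define q where "q = \<omega> k * cnj (\<omega> l)"
  have sum_q: "(\<Sum>j<n. \<omega> j ^ k * cnj (\<omega> j ^ l)) = (\<Sum>j<n. q ^ j)"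
    by (simp only: swap[of _ k] swap[of _ l] q_def power_mult_distrib complex_cnj_power)
  show ?thesis
  proof (cases "k = l")
    case True
    then show ?thesis unfolding sum_q by (simp add: q_def unit)
  next
    case False
    have "q \<noteq> 1"
    proof
      assume "q = 1"
      then have "\<omega> k = \<omega> l"
        unfolding q_def by (metis unit mult.assoc mult.commute mult.right_neutral)
      moreover have "inj_on \<omega> {..<n}"
        using Complex.bij_betw_roots_unity[of n] assms unfolding \<omega>_def bij_betw_def by simp
      ultimately show False
        using assms False by (auto dest: inj_onD)
    qed
    moreover have "\<omega> j ^ n = 1" for j
    proof -
      have "real n * (2 * pi * real j / real n) = 2 * pi * real j"
        using assms by simp
      then show ?thesis by (simp only: \<omega>_def Complex.DeMoivre) (simp add: cis_multiple_2pi)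
    qed
    then have "q ^ n = 1"
      by (simp add: q_def power_mult_distrib flip: complex_cnj_power)
    ultimately have "(\<Sum>j<n. q ^ j) = 0"
      by (simp add: geometric_sum)
    then show ?thesis
      unfolding sum_q using False by simp
  qed
qed

text \<open>Parseval's identity for trigonometric polynomials, read off at the \<open>n\<close>-th roots of unity:
  \<open>\<Sum>k<n. \<parallel>u k\<parallel>\<^sup>2\<close> is an average of values \<open>\<parallel>\<Sum>k<n. z\<^sup>k u k\<parallel>\<^sup>2\<close> with \<open>|z| = 1\<close>.\<close>

lemma sum_norm_squares_le_of_unit_circle:
  fixes u :: "nat \<Rightarrow> 'a::chilbert_space"
  assumes "n > 0" and bound: "\<And>z. cmod z = 1 \<Longrightarrow> norm (\<Sum>k<n. z ^ k *\<^sub>C u k) \<le> C"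
  shows "(\<Sum>k<n. (norm (u k))\<^sup>2) \<le> C\<^sup>2"
proof -
  define \<omega> where "\<omega> j = cis (2 * pi * real j / real n)" for j :: nat
  define y where "y j = (\<Sum>k<n. \<omega> j ^ k *\<^sub>C u k)" for j
  have "cinner (y j) (y j) = (\<Sum>k<n. \<Sum>l<n. \<omega> j ^ k * cnj (\<omega> j ^ l) * cinner (u k) (u l))" for j
    unfolding y_def cinner_sum_left
    by (simp add: cinner_sum_right cinner_scaleC_left cinner_scaleC_right mult_ac sum_distrib_left)
  then have "(\<Sum>j<n. cinner (y j) (y j)) =
      (\<Sum>j<n. \<Sum>k<n. \<Sum>l<n. \<omega> j ^ k * cnj (\<omega> j ^ l) * cinner (u k) (u l))"
    by simp
  also have "\<dots> = (\<Sum>k<n. \<Sum>l<n. (\<Sum>j<n. \<omega> j ^ k * cnj (\<omega> j ^ l)) * cinner (u k) (u l))"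
  proof -
    have "(\<Sum>j<n. \<Sum>k<n. \<Sum>l<n. f j k l) = (\<Sum>k<n. \<Sum>l<n. \<Sum>j<n. f j k l)" for f :: "nat \<Rightarrow> nat \<Rightarrow> nat \<Rightarrow> complex"
    proof -
      have "(\<Sum>j<n. \<Sum>k<n. \<Sum>l<n. f j k l) = (\<Sum>k<n. \<Sum>j<n. \<Sum>l<n. f j k l)"
        by (rule sum.swap)
      also have "\<dots> = (\<Sum>k<n. \<Sum>l<n. \<Sum>j<n. f j k l)"
        by (intro sum.cong refl sum.swap)
      finally show ?thesis .
    qed
    then show ?thesis by (simp only: sum_distrib_right)
  qed
  also have "\<dots> = (\<Sum>k<n. \<Sum>l<n. if k = l then of_nat n * cinner (u k) (u k) else 0)"
    unfolding \<omega>_def by (intro sum.cong refl) (simp add: roots_of_unity_orthogonality del: complex_cnj_power)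
  also have "\<dots> = (\<Sum>k<n. of_nat n * cinner (u k) (u k))"
    by (intro sum.cong refl) (simp add: sum.delta)
  finally have "(\<Sum>j<n. Re (cinner (y j) (y j))) = (\<Sum>k<n. Re (of_nat n * cinner (u k) (u k)))"
    by (metis Re_sum)
  then have "real n * (\<Sum>k<n. (norm (u k))\<^sup>2) = (\<Sum>j<n. (norm (y j))\<^sup>2)"
    by (simp add: Re_cinner_self cinner_self sum_distrib_left)
  also have "\<dots> \<le> (\<Sum>j<n. C\<^sup>2)"
    unfolding y_def by (intro sum_mono power_mono bound) (auto simp: \<omega>_def)
  finally show ?thesis
    using \<open>n > 0\<close> by simp
qed

text \<open>For a normal operator the norms of \<open>x, N x, N\<^sup>2 x, \<dots>\<close> are logarithmically convex, since
  \<open>\<parallel>N y\<parallel>\<^sup>2 = \<langle>y, N* N y\<rangle> \<le> \<parallel>y\<parallel> \<parallel>N\<^sup>2 y\<parallel>\<close>.\<close>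

lemma normal_norm_power_ge:
  fixes N M :: "'a::chilbert_space \<Rightarrow> 'a"
  assumes adj: "\<And>x y. cinner (N x) y = cinner x (M y)" and comm: "\<And>x. N (M x) = M (N x)"
    and x: "norm x = 1"
  shows "norm (N x) ^ k \<le> norm ((N ^^ k) x)"
proof -
  have isom: "norm (M y) = norm (N y)" for y
  proof -
    have "cinner (M y) (M y) = cinner (N y) (N y)"
      by (metis adj comm cinner_commute)
    then have "(norm (M y))\<^sup>2 = (norm (N y))\<^sup>2"
      by (metis Re_cinner_self)
    then show ?thesis by (simp add: power2_eq_iff_nonneg)
  qed
  have convex: "(norm (N y))\<^sup>2 \<le> norm y * norm (N (N y))" for y
    using cinner_Cauchy_Schwarz[of y "M (N y)"]
    by (simp add: isom cinner_self norm_power flip: adj)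
  have step: "norm (N x) * norm ((N ^^ k) x) \<le> norm ((N ^^ Suc k) x)" for k
  proof (induction k)
    case (Suc k)
    let ?a = "norm ((N ^^ k) x)" and ?b = "norm ((N ^^ Suc k) x)" and ?c = "norm ((N ^^ Suc (Suc k)) x)"
    have abc: "?b * ?b \<le> ?a * ?c"
      using convex[of "(N ^^ k) x"] by (simp add: power2_eq_square)
    show ?case
    proof (cases "?a = 0")
      case True
      then have "?b * ?b \<le> 0"
        using abc by (metis mult_zero_left)
      then have "?b = 0"
        by (metis mult_eq_0_iff norm_ge_zero order.antisym mult_nonneg_nonneg)
      then show ?thesis by simp
    next
      case False
      have "norm (N x) * ?b * ?a \<le> ?b * ?b"
        using mult_right_mono[OF Suc norm_ge_zero[of "(N ^^ Suc k) x"]] by (simp add: mult_ac)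
      also have "\<dots> \<le> ?c * ?a"
        using abc by (simp add: mult.commute)
      finally show ?thesis
        by (rule mult_right_le_imp_le) (use False in simp)
    qed
  qed (simp add: x)
  show ?thesis
  proof (induction k)
    case (Suc k)
    have "norm (N x) ^ Suc k \<le> norm (N x) * norm ((N ^^ k) x)"
      using mult_left_mono[OF Suc norm_ge_zero[of "N x"]] by simp
    then show ?case using step[of k] by linarith
  qed (simp add: x)
qed

text \<open>If the circle \<open>|\<mu>| = \<parallel>N\<parallel> = R\<close> missed the spectrum, \<open>N - \<mu>\<close> would be bounded below by one
  \<open>c > 0\<close> on it, so the geometric sums \<open>y = \<Sum>k<n. \<mu>\<^sup>-\<^sup>k N\<^sup>k x\<close>, for which \<open>(N - \<mu>) y\<close> telescopes to a
  vector of norm at most \<open>2 R\<close>, would be bounded by \<open>2 R / c\<close> for every \<open>n\<close>.  Averaging over the circle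
  gives \<open>\<Sum>k<n. \<parallel>N\<^sup>k x\<parallel>\<^sup>2 / R\<^sup>2\<^sup>k \<le> (2 R / c)\<^sup>2\<close>, whereas for normal \<open>N\<close> and a unit vector with \<open>\<parallel>N x\<parallel>\<close>
  close to \<open>R\<close> all \<open>n\<close> summands are at least \<open>1 / 2\<close>.\<close>

lemma normal_onorm_in_spectrum:
  fixes N M :: "'a::chilbert_space \<Rightarrow> 'a"
  assumes N: "bounded_clinear N"
    and adj: "\<And>x y. cinner (N x) y = cinner x (M y)" and comm: "\<And>x. N (M x) = M (N x)"
    and unit: "\<exists>x :: 'a. norm x = 1"
  shows "\<exists>\<mu>\<in>op_spectrum N. cmod \<mu> = onorm N"
proof (rule ccontr)
  assume none: "\<not> (\<exists>\<mu>\<in>op_spectrum N. cmod \<mu> = onorm N)"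
  define R where "R = onorm N"
  obtain e :: 'a where e: "norm e = 1" using unit by blast
  have "R \<ge> 0"
    using N by (auto simp: R_def intro: onorm_pos_le bounded_clinear_bounded_linear)
  have "sphere 0 R \<inter> op_spectrum N = {}"
    using none by (auto simp: R_def)
  then obtain c where c: "c > 0" "\<And>\<mu> x. cmod \<mu> = R \<Longrightarrow> c * norm x \<le> norm (shift_op N \<mu> x)"
    using uniformly_bounded_below[of "sphere 0 R" N] by auto
  have "R > 0"
  proof (rule ccontr)
    assume "\<not> R > 0"
    then have "R = 0" using \<open>R \<ge> 0\<close> by simp
    then have "norm (shift_op N 0 e) \<le> 0"
      using norm_le_onorm[OF N, of e] by (simp add: R_def shift_op_def)
    then show False
      using c(1) c(2)[of 0 e] \<open>R = 0\<close> e by simp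
  qed
  have N_pow: "norm ((N ^^ k) x) \<le> R ^ k * norm x" for k x
  proof (induction k)
    case (Suc k)
    have "norm (N ((N ^^ k) x)) \<le> R * norm ((N ^^ k) x)"
      unfolding R_def by (rule norm_le_onorm[OF N])
    also have "\<dots> \<le> R * (R ^ k * norm x)"
      by (intro mult_left_mono Suc) (use \<open>R > 0\<close> in simp)
    finally show ?case by (simp add: mult.assoc)
  qed simp
  have N_sum: "N (sum f F) = (\<Sum>i\<in>F. N (f i))" for f :: "nat \<Rightarrow> 'a" and F
    by (rule linear_sum[OF bounded_linear.linear[OF bounded_clinear_bounded_linear[OF N]]])
  define C where "C = 2 * R / c"
  have geometric: "norm (\<Sum>k<n. z ^ k *\<^sub>C (complex_of_real (1 / R ^ k) *\<^sub>C (N ^^ k) x)) \<le> C"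
    if z: "cmod z = 1" and x: "norm x = 1" for z n and x :: 'a
  proof -
    have "z \<noteq> 0" using z by auto
    \<comment> \<open>The spectral parameter for which the coefficient \<open>z\<^sup>k / R\<^sup>k\<close> equals \<open>\<mu>\<^sup>-\<^sup>k\<close>.\<close>
    define \<mu> where "\<mu> = complex_of_real R / z"
    have \<mu>: "cmod \<mu> = R"
      using z \<open>R > 0\<close> by (simp add: \<mu>_def norm_divide)
    define t where "t k = (z / complex_of_real R) ^ k *\<^sub>C (N ^^ k) x" for k
    define y where "y = (\<Sum>k<n. t k)"
    have t: "z ^ k *\<^sub>C (complex_of_real (1 / R ^ k) *\<^sub>C (N ^^ k) x) = t k" for k
      by (simp add: t_def scaleC_scaleC power_divide)
    have N_t: "N (t k) = \<mu> *\<^sub>C t (Suc k)" for k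
      using \<open>z \<noteq> 0\<close> \<open>R > 0\<close>
      by (simp add: t_def bounded_clinear_scaleC[OF N] scaleC_scaleC \<mu>_def)
    have "shift_op N \<mu> y = \<mu> *\<^sub>C (\<Sum>k<n. t (Suc k) - t k)"
      by (simp add: shift_op_def y_def N_sum N_t sum_subtractf
          complex_vector.scale_sum_right complex_vector.scale_right_diff_distrib)
    also have "\<dots> = \<mu> *\<^sub>C (t n - t 0)"
      by (simp only: sum_lessThan_telescope)
    finally have "norm (shift_op N \<mu> y) \<le> R * (norm (t n) + norm (t 0))"
      using \<mu> \<open>R > 0\<close> by (simp add: norm_scaleC norm_triangle_ineq4 mult_left_mono)
    also have "\<dots> \<le> R * (1 + 1)"
    proof -
      have "norm (t k) \<le> 1" for k
        using N_pow[of k x] x z \<open>R > 0\<close>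
        by (simp add: t_def norm_scaleC norm_power norm_divide power_divide field_simps)
      then show ?thesis
        using \<open>R > 0\<close> by (intro mult_left_mono add_mono) auto
    qed
    finally have "c * norm y \<le> 2 * R"
      using c(2)[OF \<mu>, of y] by simp
    then show ?thesis
      unfolding t y_def[symmetric] C_def using c(1) by (simp add: field_simps)
  qed
  have upper: "real n / 2 \<le> C\<^sup>2" if "n > 0" for n
  proof -
    \<comment> \<open>The \<open>n\<close> summands are at least \<open>\<rho>\<^sup>2\<^sup>k \<ge> \<rho>\<^sup>2\<^sup>n = 1 / 2\<close>.\<close>
    define \<rho> where "\<rho> = root (2 * n) (1 / 2)"
    have \<rho>: "0 < \<rho>" "\<rho> < 1" "\<rho> ^ (2 * n) = 1 / 2"
      using that by (auto simp: \<rho>_def)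
    have "\<exists>x. norm x = 1 \<and> R * \<rho> < norm (N x)"
    proof (rule ccontr)
      assume "\<nexists>x. norm x = 1 \<and> R * \<rho> < norm (N x)"
      then have "R \<le> R * \<rho>"
        unfolding R_def
        by (intro onorm_le_of_unit_bound[OF N]) (use \<rho>(1) \<open>R > 0\<close> in \<open>auto simp: R_def not_less\<close>)
      then show False
        using \<rho>(2) \<open>R > 0\<close> by simp
    qed
    then obtain x where x: "norm x = 1" "R * \<rho> < norm (N x)" by blast
    define s where "s k = norm (complex_of_real (1 / R ^ k) *\<^sub>C (N ^^ k) x)" for k
    have "1 / 2 \<le> (s k)\<^sup>2" if "k < n" for k
    proof -
      have "R ^ k * \<rho> ^ k \<le> norm (N x) ^ k"
        unfolding power_mult_distrib[symmetric]
        using x(2) \<rho>(1) \<open>R > 0\<close> by (intro power_mono) auto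
      also have "\<dots> \<le> norm ((N ^^ k) x)"
        by (rule normal_norm_power_ge[OF adj comm x(1)])
      finally have "\<rho> ^ k \<le> s k"
        using \<open>R > 0\<close> by (simp add: s_def norm_scaleC norm_divide norm_power field_simps)
      then have "(\<rho> ^ k)\<^sup>2 \<le> (s k)\<^sup>2"
        using \<rho>(1) by (intro power_mono) auto
      moreover have "\<rho> ^ (2 * n) \<le> \<rho> ^ (2 * k)"
        using \<rho> \<open>k < n\<close> by (intro power_decreasing) auto
      ultimately show ?thesis
        using \<rho>(3) by (simp add: mult.commute flip: power_mult)
    qed
    then have "(\<Sum>k<n. 1 / 2) \<le> (\<Sum>k<n. (s k)\<^sup>2)"
      by (intro sum_mono) auto
    also have "\<dots> \<le> C\<^sup>2"
      unfolding s_def by (rule sum_norm_squares_le_of_unit_circle[OF that geometric[OF _ x(1)]])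
    finally show ?thesis by simp
  qed
  obtain n :: nat where "2 * C\<^sup>2 < real n"
    using reals_Archimedean2 by blast
  then show False
    using upper[of "Suc n"] by simp
qed

text \<open>Every translate \<open>S - z\<close> is normal, hence has a spectral value of modulus \<open>\<parallel>S - z\<parallel>\<close>: discs
  around \<open>z\<close> see only the norm of \<open>S - z\<close>.\<close>

lemma normal_op_spectrum_subset_cball_iff:
  fixes S :: "'a::chilbert_space \<Rightarrow> 'a"
  assumes normal: "normal_op S" and unit: "\<exists>x :: 'a. norm x = 1"
  shows "op_spectrum S \<noteq> {}"
    and "op_spectrum S \<subseteq> cball z r \<longleftrightarrow> onorm (shift_op S z) \<le> r"
proof -
  have S: "bounded_clinear S" and comm: "S (op_adj S x) = op_adj S (S x)" for x
    using normal by (auto simp: normal_op_def fun_eq_iff)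
  have attained: "\<exists>\<mu>\<in>op_spectrum S. cmod (\<mu> - z) = onorm (shift_op S z)" for z
  proof -
    let ?N = "shift_op S z" and ?M = "\<lambda>x. op_adj S x - cnj z *\<^sub>C x"
    have adj: "cinner (?N x) y = cinner x (?M y)" for x y
      by (simp add: shift_op_def cinner_simps cinner_op_adj[OF S])
    have adj_lin: "op_adj S (x - y) = op_adj S x - op_adj S y"
      "op_adj S (w *\<^sub>C x) = w *\<^sub>C op_adj S x" for x y w
      by (rule cinner_ext; simp add: cinner_diff_right cinner_scaleC_right flip: cinner_op_adj[OF S])+
    have "?N (?M x) = ?M (?N x)" for x
      by (simp add: shift_op_def bounded_clinear_diff[OF S] bounded_clinear_scaleC[OF S] adj_lin comm
          complex_vector.scale_right_diff_distrib scaleC_scaleC mult.commute)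
    then obtain \<mu> where "\<mu> \<in> op_spectrum ?N" "cmod \<mu> = onorm ?N"
      using normal_onorm_in_spectrum[OF bounded_clinear_shift[OF S] adj _ unit] by blast
    then show ?thesis
      by (intro bexI[of _ "z + \<mu>"]) (auto simp: op_spectrum_def shift_op_shift_op)
  qed
  then show "op_spectrum S \<noteq> {}" by blast
  show "op_spectrum S \<subseteq> cball z r \<longleftrightarrow> onorm (shift_op S z) \<le> r"
  proof
    assume "op_spectrum S \<subseteq> cball z r"
    then show "onorm (shift_op S z) \<le> r"
      using attained[of z] by (auto simp: dist_norm norm_minus_commute)
  next
    assume "onorm (shift_op S z) \<le> r"
    then show "op_spectrum S \<subseteq> cball z r"
      using op_spectrum_subset_cball[OF S, of z] subset_cball by blast
  qed
qed

text \<open>Two different discs of radius \<open>r\<close> intersect in a lens contained in a strictly smaller disc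
  around the midpoint of the centres.\<close>

lemma smallest_disc_unique:
  assumes "K \<noteq> {}" and D: "smallest_disc K D" and E: "smallest_disc K E"
  shows "D = E"
proof -
  obtain a r b where D_eq: "D = (a, r)" and E_eq: "E = (b, r)"
    using D E by (metis order.antisym prod.collapse smallest_disc_def)
  have sub: "K \<subseteq> cball a r" "K \<subseteq> cball b r" and least: "\<And>c s. K \<subseteq> cball c s \<Longrightarrow> r \<le> s"
    using D E by (auto simp: smallest_disc_def D_eq E_eq)
  define m where "m = (a + b) / 2"
  define q where "q = r\<^sup>2 - (cmod (a - b))\<^sup>2 / 4"
  have near: "(cmod (k - m))\<^sup>2 \<le> q" if "k \<in> K" for k
  proof -
    have "cmod (k - a) \<le> r" "cmod (k - b) \<le> r"
      using sub that by (auto simp: dist_norm norm_minus_commute subset_iff)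
    then have "(cmod (k - a))\<^sup>2 \<le> r\<^sup>2" "(cmod (k - b))\<^sup>2 \<le> r\<^sup>2"
      by (auto intro: power_mono)
    moreover have "(cmod (k - m))\<^sup>2 = (cmod (k - a))\<^sup>2 / 2 + (cmod (k - b))\<^sup>2 / 2 - (cmod (a - b))\<^sup>2 / 4"
      unfolding cmod_power2 m_def by (simp add: power2_eq_square field_simps)
    ultimately show ?thesis by (simp add: q_def)
  qed
  obtain k where "k \<in> K" using \<open>K \<noteq> {}\<close> by blast
  then have "q \<ge> 0" using near[of k] zero_le_power2 order.trans by blast
  have "r \<ge> 0"
    using \<open>k \<in> K\<close> sub(1) by (metis mem_cball order.trans subsetD zero_le_dist)
  have "cmod (k - m) \<le> sqrt q" if "k \<in> K" for k
    by (rule real_le_rsqrt[OF near[OF that]])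
  then have "K \<subseteq> cball m (sqrt q)"
    by (auto simp: dist_norm norm_minus_commute)
  then have "r \<le> sqrt q" by (rule least)
  then have "r\<^sup>2 \<le> q"
    using \<open>r \<ge> 0\<close> \<open>q \<ge> 0\<close> by (metis power_mono real_sqrt_pow2)
  then have "a = b" by (simp add: q_def)
  then show ?thesis by (simp add: D_eq E_eq)
qed

text \<open>By the equivalence above, a disc enclosing the spectrum with the least radius is the same as
  a best approximation of \<open>S\<close> by scalars.\<close>

lemma normal_dist_scalars_eq:
  fixes S :: "'a::chilbert_space \<Rightarrow> 'a"
  assumes normal: "normal_op S" and unit: "\<exists>x :: 'a. norm x = 1"
  shows "dist_scalars S = spectral_disc_radius S"
proof -
  have S: "bounded_clinear S"
    using normal by (simp add: normal_op_def)
  obtain c where c: "dist_scalars S = onorm (shift_op S c)"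
      "\<And>z. onorm (shift_op S c) \<le> onorm (shift_op S z)"
    using dist_scalars_attained[OF S unit] by metis
  have "smallest_disc (op_spectrum S) (c, dist_scalars S)"
    unfolding smallest_disc_def normal_op_spectrum_subset_cball_iff(2)[OF normal unit]
    using c by (auto intro: order.trans)
  then have "(THE D. smallest_disc (op_spectrum S) D) = (c, dist_scalars S)"
    using smallest_disc_unique[OF normal_op_spectrum_subset_cball_iff(1)[OF normal unit]]
    by (intro the_equality) auto
  then show ?thesis
    by (simp add: spectral_disc_radius_def)
qed

section \<open>The covariance inequality\<close>

text \<open>The covariance of \<open>A - z\<close> and \<open>T - w\<close> is that of \<open>A\<close> and \<open>T\<close>, because a state has total mass
  \<open>1\<close>.\<close>

lemma density_covariance_bound:
  fixes A T Q :: "'a::chilbert_space \<Rightarrow> 'a"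
  assumes A: "bounded_clinear A" and T: "bounded_clinear T" and Q: "Q \<in> density_operators"
  shows "cmod (op_trace (Q \<circ> A \<circ> T) - op_trace (Q \<circ> A) * op_trace (Q \<circ> T))
    \<le> onorm (shift_op A z) * onorm (shift_op T w)"
proof -
  define B :: "'a set" where "B = (SOME B. orthonormal_basis B)"
  have trace: "op_trace S = (\<Sum>\<^sub>\<infinity>e\<in>B. cinner (S e) e)" for S :: "'a \<Rightarrow> 'a"
    by (simp add: op_trace_def B_def)
  have Q_pos: "positive_op Q" and Q_tr: "op_trace Q = 1" and "trace_class Q"
    using Q by (auto simp: density_operators_def)
  then have B: "orthonormal_basis B"
    unfolding B_def by (metis someI_ex trace_class_def)
  \<comment> \<open>A divergent sum has the default value \<open>0\<close>, so trace \<open>1\<close> forces convergence in the basis that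
    defines the trace.\<close>
  have "(\<lambda>e. cinner (Q e) e) summable_on B"
    using Q_tr infsum_not_exists[of "\<lambda>e. cinner (Q e) e" B] by (auto simp: trace)
  then obtain v :: "nat \<Rightarrow> 'a" where v: "\<And>S. bounded_clinear S \<Longrightarrow>
      ((\<lambda>n. cinner (S (v n)) (v n)) has_sum op_trace (Q \<circ> S)) UNIV"
    using trace_as_vector_states[OF Q_pos B] by (auto simp: trace)
  let ?a = "op_trace (Q \<circ> A)" and ?t = "op_trace (Q \<circ> T)" and ?at = "op_trace (Q \<circ> A \<circ> T)"
  have one: "((\<lambda>n. cinner (v n) (v n)) has_sum 1) UNIV"
    using v[OF bounded_clinear_id] Q_tr by simp
  have a: "((\<lambda>n. cinner (A (v n)) (v n)) has_sum ?a) UNIV"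
    and t: "((\<lambda>n. cinner (T (v n)) (v n)) has_sum ?t) UNIV"
    by (rule v[OF A], rule v[OF T])
  have at: "((\<lambda>n. cinner (A (T (v n))) (v n)) has_sum ?at) UNIV"
    using v[OF bounded_clinear_compose[OF A T]] by (simp add: o_assoc)
  have a': "((\<lambda>n. cinner (shift_op A z (v n)) (v n)) has_sum (?a + (- z) * 1)) UNIV"
    using has_sum_add[OF a has_sum_cmult_right[OF one, of "- z"]]
    by (simp add: shift_op_def cinner_diff_left cinner_scaleC_left)
  have t': "((\<lambda>n. cinner (shift_op T w (v n)) (v n)) has_sum (?t + (- w) * 1)) UNIV"
    using has_sum_add[OF t has_sum_cmult_right[OF one, of "- w"]]
    by (simp add: shift_op_def cinner_diff_left cinner_scaleC_left)
  have at': "((\<lambda>n. cinner (shift_op A z (shift_op T w (v n))) (v n)) has_sum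
      (?at + (- w) * ?a + ((- z) * ?t + z * w * 1))) UNIV"
  proof -
    have "cinner (shift_op A z (shift_op T w x)) x =
        cinner (A (T x)) x + (- w) * cinner (A x) x + ((- z) * cinner (T x) x + z * w * cinner x x)" for x
      by (simp add: shift_op_def cinner_simps bounded_clinear_diff[OF A] bounded_clinear_scaleC[OF A]
          right_diff_distrib)
    then show ?thesis
      by (simp only:) (intro has_sum_add has_sum_cmult_right one a t at)
  qed
  have "?at - ?a * ?t = (?at + (- w) * ?a + ((- z) * ?t + z * w * 1)) - (?a + (- z) * 1) * (?t + (- w) * 1)"
    by (simp add: algebra_simps)
  then show ?thesis
    using covariance_bound[OF bounded_clinear_shift[OF A] bounded_clinear_shift[OF T] one a' t' at']
    by (simp only:)
qed

theorem proposition3p5: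
  fixes A T P :: "'a::chilbert_space \<Rightarrow> 'a"
    and a\<^sub>0 t\<^sub>0 :: complex and R\<^sub>A R\<^sub>T :: real
  assumes "separable_space (euclidean :: 'a topology)"
    and "bounded_clinear A" and "bounded_clinear T"
    and "P \<in> density_operators"
  shows
    "(numerical_range A \<subseteq> cball a\<^sub>0 R\<^sub>A \<and> numerical_range T \<subseteq> cball t\<^sub>0 R\<^sub>T \<longrightarrow>
       cmod (op_trace (P \<circ> A \<circ> T) - op_trace (P \<circ> A) * op_trace (P \<circ> T))
         \<le> (SUP Q\<in>density_operators.
               cmod (op_trace (Q \<circ> A \<circ> T) - op_trace (Q \<circ> A) * op_trace (Q \<circ> T))) \<and>
       (SUP Q\<in>density_operators.
           cmod (op_trace (Q \<circ> A \<circ> T) - op_trace (Q \<circ> A) * op_trace (Q \<circ> T)))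
         \<le> dist_scalars A * dist_scalars T \<and>
       dist_scalars A * dist_scalars T
         \<le> onorm (shift_op A a\<^sub>0) * onorm (shift_op T t\<^sub>0) \<and>
       onorm (shift_op A a\<^sub>0) * onorm (shift_op T t\<^sub>0)
         \<le> 4 * numerical_radius (shift_op A a\<^sub>0) * numerical_radius (shift_op T t\<^sub>0) \<and>
       4 * numerical_radius (shift_op A a\<^sub>0) * numerical_radius (shift_op T t\<^sub>0)
         \<le> 4 * R\<^sub>A * R\<^sub>T) \<and>
     (normal_op A \<and> normal_op T \<longrightarrow>
       cmod (op_trace (P \<circ> A \<circ> T) - op_trace (P \<circ> A) * op_trace (P \<circ> T))
         \<le> (SUP Q\<in>density_operators.
               cmod (op_trace (Q \<circ> A \<circ> T) - op_trace (Q \<circ> A) * op_trace (Q \<circ> T))) \<and>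
       (SUP Q\<in>density_operators.
           cmod (op_trace (Q \<circ> A \<circ> T) - op_trace (Q \<circ> A) * op_trace (Q \<circ> T)))
         \<le> dist_scalars A * dist_scalars T \<and>
       dist_scalars A * dist_scalars T = spectral_disc_radius A * spectral_disc_radius T)"
proof -
  note A = assms(2) and T = assms(3) and P = assms(4)
  let ?cov = "\<lambda>Q. cmod (op_trace (Q \<circ> A \<circ> T) - op_trace (Q \<circ> A) * op_trace (Q \<circ> T))"
  \<comment> \<open>States exist only on nonzero spaces, where unit vectors are available.\<close>
  have unit: "\<exists>x :: 'a. norm x = 1"
  proof (rule ccontr)
    assume "\<nexists>x :: 'a. norm x = 1"
    then have "x = 0" for x :: 'a
      by (metis norm_sgn)
    then have "op_trace P = 0"
      unfolding op_trace_def by (metis cinner_zero_right infsum_0)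
    then show False
      using P by (simp add: density_operators_def)
  qed
  obtain a where a: "dist_scalars A = onorm (shift_op A a)"
      "\<And>z. onorm (shift_op A a) \<le> onorm (shift_op A z)"
    using dist_scalars_attained[OF A unit] by metis
  obtain t where t: "dist_scalars T = onorm (shift_op T t)"
      "\<And>z. onorm (shift_op T t) \<le> onorm (shift_op T z)"
    using dist_scalars_attained[OF T unit] by metis
  have bound: "?cov Q \<le> dist_scalars A * dist_scalars T" if "Q \<in> density_operators" for Q
    unfolding a(1) t(1) by (rule density_covariance_bound[OF A T that])
  have pos: "0 \<le> onorm (shift_op A z)" "0 \<le> onorm (shift_op T z)" for z
    using A T by (auto intro: onorm_pos_le bounded_clinear_bounded_linear bounded_clinear_shift)
  have le_Sup: "?cov P \<le> (SUP Q\<in>density_operators. ?cov Q)"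
    by (intro cSUP_upper P bdd_aboveI2[where M = "dist_scalars A * dist_scalars T"] bound)
  have Sup_le: "(SUP Q\<in>density_operators. ?cov Q) \<le> dist_scalars A * dist_scalars T"
    using P by (intro cSUP_least bound) auto
  have dist_le: "dist_scalars A * dist_scalars T \<le> onorm (shift_op A a\<^sub>0) * onorm (shift_op T t\<^sub>0)"
    unfolding a(1) t(1) by (intro mult_mono a(2) t(2) pos)
  note wA = onorm_le_numerical_radius[OF bounded_clinear_shift[OF A, of a\<^sub>0] unit]
  note wT = onorm_le_numerical_radius[OF bounded_clinear_shift[OF T, of t\<^sub>0] unit]
  have onorm_le: "onorm (shift_op A a\<^sub>0) * onorm (shift_op T t\<^sub>0)
      \<le> 4 * numerical_radius (shift_op A a\<^sub>0) * numerical_radius (shift_op T t\<^sub>0)"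
    using mult_mono[OF wA(2) wT(2)] wA(1) pos by simp
  have radius_le: "4 * numerical_radius (shift_op A a\<^sub>0) * numerical_radius (shift_op T t\<^sub>0)
      \<le> 4 * R\<^sub>A * R\<^sub>T"
    if "numerical_range A \<subseteq> cball a\<^sub>0 R\<^sub>A" "numerical_range T \<subseteq> cball t\<^sub>0 R\<^sub>T"
  proof -
    have "numerical_radius (shift_op A a\<^sub>0) \<le> R\<^sub>A" "numerical_radius (shift_op T t\<^sub>0) \<le> R\<^sub>T"
      using that unit by (auto intro: numerical_radius_shift_le)
    then show ?thesis
      using wA(1) wT(1) by (simp add: mult.assoc mult_mono')
  qed
  have normal: "dist_scalars A * dist_scalars T = spectral_disc_radius A * spectral_disc_radius T"
    if "normal_op A" "normal_op T"
    using that unit by (simp add: normal_dist_scalars_eq)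
  show ?thesis
    by (intro conjI impI; (elim conjE)?;
        rule le_Sup Sup_le dist_le onorm_le radius_le normal; assumption?)
qed

end
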